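(* Let $1\to A\to G\to Q\to 1$ be a universal central extension of groups. Then the image of the natural map $H_3(A,\mathbb{Z})\to H_3(G,\mathbb{Z})$ induced by the inclusion $A\hookrightarrow G$ is $2$-torsion.
   Context: $H_n(-,\mathbb{Z})$ denotes integral group homology. A universal central extension of $Q$ (which exists exactly when $Q$ is perfect) is a central extension of $Q$ that maps uniquely, over $Q$, to every central extension of $Q$. An abelian group is called $2$-torsion if each of its elements $x$ satisfies $2x=0$. *)

theory Defs
  imports "HOL-Algebra.Free_Abelian_Groups" "HOL-Algebra.Weak_Morphisms"
begin

section \<open>Integral group homology\<close>

text \<open>
  \<open>H\<^sub>n(G, \<int>)\<close> is the homology of the (unnormalised, inhomogeneous) bar complex: \<open>C\<^sub>n(G)\<close> is
  the free abelian group on the \<open>n\<close>-tuples \<open>[g\<^sub>1|\<dots>|g\<^sub>n]\<close> of elements of \<open>G\<close>, and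
  \<open>\<partial>[g\<^sub>1|\<dots>|g\<^sub>n] = [g\<^sub>2|\<dots>|g\<^sub>n] + \<Sum>\<^sub>0\<^sub><\<^sub>i\<^sub><\<^sub>n (-1)\<^sup>i [g\<^sub>1|\<dots>|g\<^sub>i g\<^sub>i\<^sub>+\<^sub>1|\<dots>|g\<^sub>n] + (-1)\<^sup>n [g\<^sub>1|\<dots>|g\<^sub>n\<^sub>-\<^sub>1]\<close>.
\<close>

definition bar_tuples :: "nat \<Rightarrow> ('a, 'm) monoid_scheme \<Rightarrow> 'a list set" where
  "bar_tuples n G = {xs. length xs = n \<and> set xs \<subseteq> carrier G}"

definition bar_chain_group :: "nat \<Rightarrow> ('a, 'm) monoid_scheme \<Rightarrow> ('a list \<Rightarrow>\<^sub>0 int) monoid" where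
  "bar_chain_group n G = free_Abelian_group (bar_tuples n G)"

text \<open>Lists are indexed from 0, so the \<open>i\<close>-th face multiplies the entries \<open>xs ! (i - 1)\<close> and \<open>xs ! i\<close>.\<close>

definition bar_face :: "('a, 'm) monoid_scheme \<Rightarrow> nat \<Rightarrow> 'a list \<Rightarrow> 'a list" where
  "bar_face G i xs =
    (if i = 0 then tl xs
     else if i = length xs then butlast xs
     else take (i - 1) xs @ (xs ! (i - 1) \<otimes>\<^bsub>G\<^esub> xs ! i) # drop (i + 1) xs)"

definition bar_boundary ::
    "('a, 'm) monoid_scheme \<Rightarrow> ('a list \<Rightarrow>\<^sub>0 int) \<Rightarrow> ('a list \<Rightarrow>\<^sub>0 int)" where
  "bar_boundary G =
    frag_extend (\<lambda>xs. if xs = [] then 0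
                      else \<Sum>i\<le>length xs. frag_cmul ((-1) ^ i) (frag_of (bar_face G i xs)))"

definition bar_cycles :: "nat \<Rightarrow> ('a, 'm) monoid_scheme \<Rightarrow> ('a list \<Rightarrow>\<^sub>0 int) set" where
  "bar_cycles n G = {c \<in> carrier (bar_chain_group n G). bar_boundary G c = 0}"

definition bar_boundaries :: "nat \<Rightarrow> ('a, 'm) monoid_scheme \<Rightarrow> ('a list \<Rightarrow>\<^sub>0 int) set" where
  "bar_boundaries n G = bar_boundary G ` carrier (bar_chain_group (Suc n) G)"

definition bar_cycle_group :: "nat \<Rightarrow> ('a, 'm) monoid_scheme \<Rightarrow> ('a list \<Rightarrow>\<^sub>0 int) monoid" where
  "bar_cycle_group n G = (bar_chain_group n G)\<lparr>carrier := bar_cycles n G\<rparr>"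

definition group_homology :: "nat \<Rightarrow> ('a, 'm) monoid_scheme \<Rightarrow> ('a list \<Rightarrow>\<^sub>0 int) set monoid" where
  "group_homology n G = bar_cycle_group n G Mod bar_boundaries n G"

definition bar_map :: "('a \<Rightarrow> 'b) \<Rightarrow> ('a list \<Rightarrow>\<^sub>0 int) \<Rightarrow> ('b list \<Rightarrow>\<^sub>0 int)" where
  "bar_map f = frag_extend (frag_of \<circ> map f)"

text \<open>
  The union below is over the representatives \<open>c\<close> of a homology class of the domain; they all
  contribute the same coset (lemma \<open>group_homology_map_coset\<close>).
\<close>

definition group_homology_map ::
    "nat \<Rightarrow> ('b, 'm) monoid_scheme \<Rightarrow> ('a \<Rightarrow> 'b) \<Rightarrow> ('a list \<Rightarrow>\<^sub>0 int) set \<Rightarrow> ('b list \<Rightarrow>\<^sub>0 int) set" where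
  "group_homology_map n H f X = (\<Union>c\<in>X. bar_boundaries n H #>\<^bsub>bar_cycle_group n H\<^esub> bar_map f c)"

subsection \<open>The bar complex is a functorial chain complex\<close>

lemma bar_face_in_tuples:
  assumes "group G" "xs \<in> bar_tuples (Suc n) G" "i \<le> Suc n"
  shows "bar_face G i xs \<in> bar_tuples n G"
proof -
  interpret group G by fact
  have len: "length xs = Suc n" and car: "set xs \<subseteq> carrier G"
    using assms(2) by (auto simp: bar_tuples_def)
  have nth: "xs ! k \<in> carrier G" if "k < Suc n" for k
    using that len car by (metis nth_mem subsetD)
  show ?thesis
  proof (cases "i = 0 \<or> i = length xs")
    case True
    then show ?thesis
      using len car by (cases xs) (auto simp: bar_tuples_def bar_face_def dest: in_set_butlastD)
  next
    case False
    then have "xs ! (i - 1) \<otimes>\<^bsub>G\<^esub> xs ! i \<in> carrier G"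
      using nth assms(3) len by (intro m_closed) auto
    then show ?thesis
      using False assms(3) len car
      by (auto simp: bar_tuples_def bar_face_def dest!: in_set_takeD in_set_dropD)
  qed
qed

lemma nth_bar_face:
  assumes "length xs = Suc n" "i \<le> Suc n" "k < n"
  shows "bar_face G i xs ! k =
    (if Suc k < i then xs ! k
     else if Suc k = i then xs ! k \<otimes>\<^bsub>G\<^esub> xs ! Suc k
     else xs ! Suc k)"
proof (cases "i = 0 \<or> i = length xs")
  case True
  then show ?thesis
    using assms by (auto simp: bar_face_def nth_tl nth_butlast)
next
  case False
  then show ?thesis
    using assms by (auto simp: bar_face_def nth_append nth_Cons' Suc_diff_Suc)
qed

lemma bar_face_bar_face:
  assumes "group G" "xs \<in> bar_tuples (Suc (Suc n)) G" "i < j" "j \<le> Suc (Suc n)"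
  shows "bar_face G i (bar_face G j xs) = bar_face G (j - 1) (bar_face G i xs)"
proof (rule nth_equalityI)
  interpret group G by fact
  have len: "length xs = Suc (Suc n)" and car: "set xs \<subseteq> carrier G"
    using assms(2) by (auto simp: bar_tuples_def)
  have fj: "bar_face G j xs \<in> bar_tuples (Suc n) G" and fi: "bar_face G i xs \<in> bar_tuples (Suc n) G"
    using bar_face_in_tuples[OF assms(1,2)] assms(3,4) by auto
  have lj: "length (bar_face G j xs) = Suc n" and li: "length (bar_face G i xs) = Suc n"
    using fi fj by (auto simp: bar_tuples_def)
  have l1: "length (bar_face G i (bar_face G j xs)) = n"
    using bar_face_in_tuples[OF assms(1) fj, of i] assms(3,4) by (auto simp: bar_tuples_def)
  have l2: "length (bar_face G (j - 1) (bar_face G i xs)) = n"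
    using bar_face_in_tuples[OF assms(1) fi, of "j - 1"] assms(3,4) by (auto simp: bar_tuples_def)
  show "length (bar_face G i (bar_face G j xs)) = length (bar_face G (j - 1) (bar_face G i xs))"
    using l1 l2 by simp
  fix k assume "k < length (bar_face G i (bar_face G j xs))"
  then have k: "k < n" using l1 by simp
  have nth: "xs ! l \<in> carrier G" if "l < Suc (Suc n)" for l
    using that len car by (metis nth_mem subsetD)
  show "bar_face G i (bar_face G j xs) ! k = bar_face G (j - 1) (bar_face G i xs) ! k"
    using assms(3,4) k nth[of k] nth[of "Suc k"] nth[of "Suc (Suc k)"]
    by (auto simp: nth_bar_face[OF lj] nth_bar_face[OF li] nth_bar_face[OF len] m_assoc)
qed

lemma bar_boundary_diff: "bar_boundary G (a - b) = bar_boundary G a - bar_boundary G b"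
  by (simp add: bar_boundary_def frag_extend_diff)

lemma bar_boundary_0 [simp]: "bar_boundary G 0 = 0"
  by (simp add: bar_boundary_def)

lemma bar_boundary_minus: "bar_boundary G (- a) = - bar_boundary G a"
  by (simp add: bar_boundary_def frag_extend_minus)

lemma bar_boundary_add: "bar_boundary G (a + b) = bar_boundary G a + bar_boundary G b"
  by (simp add: bar_boundary_def frag_extend_add)

lemma bar_boundary_sum:
  "finite I \<Longrightarrow> bar_boundary G (\<Sum>i\<in>I. g i) = (\<Sum>i\<in>I. bar_boundary G (g i))"
  by (simp add: bar_boundary_def frag_extend_sum o_def)

lemma bar_boundary_cmul: "bar_boundary G (frag_cmul k c) = frag_cmul k (bar_boundary G c)"
  by (simp add: bar_boundary_def frag_extend_cmul)

lemma bar_boundary_frag_of: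
  "bar_boundary G (frag_of xs) =
    (if xs = [] then 0 else \<Sum>i\<le>length xs. frag_cmul ((-1) ^ i) (frag_of (bar_face G i xs)))"
  by (simp add: bar_boundary_def)

lemma bar_boundary_in_chains:
  assumes "group G" "c \<in> carrier (bar_chain_group (Suc n) G)"
  shows "bar_boundary G c \<in> carrier (bar_chain_group n G)"
proof -
  have "Poly_Mapping.keys c \<subseteq> bar_tuples (Suc n) G"
    using assms(2) by (simp add: bar_chain_group_def)
  then have "bar_boundary G c \<in> carrier (free_Abelian_group (bar_tuples n G))"
  proof (induction c rule: frag_induction)
    case zero
    then show ?case by simp
  next
    case (one xs)
    then have "length xs = Suc n" by (simp add: bar_tuples_def)
    moreover have "frag_cmul ((-1) ^ i) (frag_of (bar_face G i xs))
        \<in> carrier (free_Abelian_group (bar_tuples n G))" if "i \<le> Suc n" for i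
      using bar_face_in_tuples[OF assms(1) one that] keys_cmul
      by (fastforce simp: keys_frag_of)
    ultimately show ?case
      by (auto simp: bar_boundary_frag_of simp del: carrier_free_Abelian_group_iff sum.atMost_Suc
          intro!: sum_closed_free_Abelian_group)
  next
    case (diff a b)
    then show ?case
      using keys_diff[of "bar_boundary G a" "bar_boundary G b"] by (auto simp: bar_boundary_diff)
  qed
  then show ?thesis by (simp add: bar_chain_group_def)
qed

lemma alternating_double_sum:
  fixes F :: "nat \<Rightarrow> nat \<Rightarrow> ('b \<Rightarrow>\<^sub>0 int)"
  assumes "\<And>i j. \<lbrakk>i < j; j \<le> Suc N\<rbrakk> \<Longrightarrow> F i j = F (j - 1) i"
  shows "(\<Sum>j\<le>Suc N. \<Sum>i\<le>N. frag_cmul ((-1) ^ (i + j)) (F i j)) = 0"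
proof -
  let ?T = "\<lambda>(j, i). frag_cmul ((-1) ^ (i + j)) (F i j)"
  let ?L = "{p \<in> {..Suc N} \<times> {..N}. snd p < fst p}"
  let ?U = "{p \<in> {..Suc N} \<times> {..N}. fst p \<le> snd p}"
  have "(\<Sum>j\<le>Suc N. \<Sum>i\<le>N. frag_cmul ((-1) ^ (i + j)) (F i j)) = sum ?T ({..Suc N} \<times> {..N})"
    by (simp only: sum.cartesian_product)
  also have "{..Suc N} \<times> {..N} = ?L \<union> ?U" by auto
  also have "sum ?T (?L \<union> ?U) = sum ?T ?L + sum ?T ?U"
    by (rule sum.union_disjoint) (auto intro: finite_subset[of _ "{..Suc N} \<times> {..N}"])
  also have "sum ?T ?L = (\<Sum>p\<in>?U. - ?T p)"
  proof (rule sum.reindex_bij_witness[where i = "\<lambda>(j, i). (Suc i, j)" and j = "\<lambda>(j, i). (i, j - 1)"])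
    fix p assume p: "p \<in> ?L"
    obtain j i where ji: "p = (j, i)" by force
    with p have "i < j" "j \<le> Suc N" by auto
    moreover from \<open>i < j\<close> obtain m where "j = Suc m" by (cases j) auto
    ultimately show "- ?T (case p of (j, i) \<Rightarrow> (i, j - 1)) = ?T p"
      using assms[of i j] ji by (simp add: add.commute)
  qed auto
  finally show ?thesis by (simp add: sum_negf)
qed

lemma bar_boundary_boundary:
  assumes "group G" "c \<in> carrier (bar_chain_group n G)"
  shows "bar_boundary G (bar_boundary G c) = 0"
proof -
  have "Poly_Mapping.keys c \<subseteq> bar_tuples n G"
    using assms(2) by (simp add: bar_chain_group_def)
  then show ?thesis
  proof (induction c rule: frag_induction)
    case (one xs)
    then have len: "length xs = n" by (simp add: bar_tuples_def)
    consider "n = 0" | "n = Suc 0" | N where "n = Suc (Suc N)"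
      by (metis not0_implies_Suc)
    then show ?case
    proof cases
      case 1
      then show ?thesis using len by (simp add: bar_boundary_frag_of)
    next
      case 2
      then show ?thesis
        using len by (auto simp: length_Suc_conv bar_boundary_frag_of bar_face_def bar_boundary_diff)
    next
      case 3
      have lf: "length (bar_face G j xs) = Suc N" if "j \<le> Suc (Suc N)" for j
        using bar_face_in_tuples[OF assms(1), of xs "Suc N" j] one that 3 by (auto simp: bar_tuples_def)
      have "bar_boundary G (bar_boundary G (frag_of xs)) =
          (\<Sum>j\<le>n. frag_cmul ((-1) ^ j) (bar_boundary G (frag_of (bar_face G j xs))))"
        using len 3 by (auto simp: bar_boundary_frag_of[of _ xs] bar_boundary_sum bar_boundary_cmul
            simp del: sum.atMost_Suc)
      also have "\<dots> = (\<Sum>j\<le>Suc (Suc N). \<Sum>i\<le>Suc N.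
          frag_cmul ((-1) ^ (i + j)) (frag_of (bar_face G i (bar_face G j xs))))"
      proof (rule sum.cong)
        fix j assume "j \<in> {..Suc (Suc N)}"
        then have "length (bar_face G j xs) = Suc N" using lf by simp
        moreover from this have "bar_face G j xs \<noteq> []" by auto
        ultimately show "frag_cmul ((-1) ^ j) (bar_boundary G (frag_of (bar_face G j xs))) =
            (\<Sum>i\<le>Suc N. frag_cmul ((-1) ^ (i + j)) (frag_of (bar_face G i (bar_face G j xs))))"
          by (simp add: bar_boundary_frag_of frag_cmul_sum power_add mult.commute
              del: sum.atMost_Suc)
      qed (use 3 in auto)
      also have "\<dots> = 0"
        by (rule alternating_double_sum) (use bar_face_bar_face[OF assms(1)] one 3 in auto)
      finally show ?thesis .
    qed
  qed (auto simp: bar_boundary_diff)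
qed

lemma bar_boundaries_subset_cycles:
  "group G \<Longrightarrow> bar_boundaries n G \<subseteq> bar_cycles n G"
  by (auto simp: bar_boundaries_def bar_cycles_def bar_boundary_in_chains bar_boundary_boundary)

lemma bar_chain_group_simps [simp]:
  "\<one>\<^bsub>bar_chain_group n G\<^esub> = 0"
  "x \<otimes>\<^bsub>bar_chain_group n G\<^esub> y = x + y"
  "group (bar_chain_group n G)"
  "comm_group (bar_chain_group n G)"
  by (auto simp: bar_chain_group_def abelian_free_Abelian_group)

lemma bar_cycle_group_simps [simp]:
  "carrier (bar_cycle_group n G) = bar_cycles n G"
  "\<one>\<^bsub>bar_cycle_group n G\<^esub> = 0"
  "x \<otimes>\<^bsub>bar_cycle_group n G\<^esub> y = x + y"
  by (auto simp: bar_cycle_group_def)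

lemma bar_chains_diff:
  "\<lbrakk>a \<in> carrier (bar_chain_group n G); b \<in> carrier (bar_chain_group n G)\<rbrakk>
    \<Longrightarrow> a - b \<in> carrier (bar_chain_group n G)"
  using keys_diff[of a b] by (auto simp: bar_chain_group_def)

lemma bar_chains_0 [simp]: "0 \<in> carrier (bar_chain_group n G)"
  by (simp add: bar_chain_group_def)

lemma subgroup_bar_chain_groupI:
  assumes "Z \<subseteq> carrier (bar_chain_group n G)" "0 \<in> Z" "\<And>a b. \<lbrakk>a \<in> Z; b \<in> Z\<rbrakk> \<Longrightarrow> a - b \<in> Z"
  shows "subgroup Z (bar_chain_group n G)"
proof -
  have minus: "- a \<in> Z" if "a \<in> Z" for a
    using assms(3)[OF assms(2) that] by simp
  have "inv\<^bsub>bar_chain_group n G\<^esub> a = - a" if "a \<in> Z" for a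
    using assms(1) that by (auto simp: bar_chain_group_def)
  moreover have "a + b \<in> Z" if "a \<in> Z" "b \<in> Z" for a b
    using assms(3)[OF that(1) minus[OF that(2)]] by simp
  ultimately show ?thesis
    using assms(1,2) minus by unfold_locales auto
qed

lemma subgroup_bar_cycles: "subgroup (bar_cycles n G) (bar_chain_group n G)"
  by (rule subgroup_bar_chain_groupI) (auto simp: bar_cycles_def bar_boundary_diff bar_chains_diff)

lemma subgroup_bar_boundaries:
  assumes "group G"
  shows "subgroup (bar_boundaries n G) (bar_chain_group n G)"
proof (rule subgroup_bar_chain_groupI)
  show "bar_boundaries n G \<subseteq> carrier (bar_chain_group n G)"
    using bar_boundaries_subset_cycles[OF assms] by (auto simp: bar_cycles_def)
  show "0 \<in> bar_boundaries n G"
    unfolding bar_boundaries_def using bar_chains_0 by (metis bar_boundary_0 imageI)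
  show "a - b \<in> bar_boundaries n G" if "a \<in> bar_boundaries n G" "b \<in> bar_boundaries n G" for a b
    using that unfolding bar_boundaries_def
    by (auto simp flip: bar_boundary_diff intro!: imageI bar_chains_diff)
qed

lemma comm_group_bar_cycle_group: "comm_group (bar_cycle_group n G)"
proof (rule group.group_comm_groupI)
  show "group (bar_cycle_group n G)"
    unfolding bar_cycle_group_def by (rule group.subgroup_imp_group) (auto intro: subgroup_bar_cycles)
qed (simp add: add.commute)

lemma normal_bar_boundaries:
  assumes "group G"
  shows "bar_boundaries n G \<lhd> bar_cycle_group n G"
proof -
  interpret comm_group "bar_cycle_group n G" by (rule comm_group_bar_cycle_group)
  have "subgroup (bar_boundaries n G) (bar_cycle_group n G)"
    unfolding bar_cycle_group_def
    by (rule group.subgroup_incl)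
       (auto intro: subgroup_bar_boundaries[OF assms] subgroup_bar_cycles
          bar_boundaries_subset_cycles[OF assms, THEN subsetD])
  then show ?thesis by (rule normal_iff_subgroup[THEN iffD2])
qed

lemma comm_group_group_homology:
  assumes "group G"
  shows "comm_group (group_homology n G)"
proof -
  interpret comm_group "bar_cycle_group n G" by (rule comm_group_bar_cycle_group)
  show ?thesis
    unfolding group_homology_def
    by (rule abelian_FactGroup) (use normal_bar_boundaries[OF assms] in \<open>simp add: normal_def\<close>)
qed

lemma bar_map_simps:
  "bar_map f (frag_of xs) = frag_of (map f xs)"
  "bar_map f 0 = 0"
  "bar_map f (a + b) = bar_map f a + bar_map f b"
  "bar_map f (a - b) = bar_map f a - bar_map f b"
  "bar_map f (frag_cmul k c) = frag_cmul k (bar_map f c)"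
  "finite I \<Longrightarrow> bar_map f (\<Sum>i\<in>I. g i) = (\<Sum>i\<in>I. bar_map f (g i))"
  by (simp_all add: bar_map_def frag_extend_add frag_extend_diff frag_extend_cmul frag_extend_sum o_def)

lemma bar_map_in_chains:
  assumes "f \<in> hom G H" "c \<in> carrier (bar_chain_group n G)"
  shows "bar_map f c \<in> carrier (bar_chain_group n H)"
proof -
  have "Poly_Mapping.keys (bar_map f c) \<subseteq> map f ` Poly_Mapping.keys c"
    using keys_frag_extend[of "frag_of \<circ> map f" c] by (auto simp: bar_map_def keys_frag_of)
  with assms show ?thesis
    by (fastforce simp: bar_chain_group_def bar_tuples_def hom_def Pi_iff)
qed

lemma bar_face_map:
  assumes "f \<in> hom G H" "xs \<in> bar_tuples n G" "i \<le> n"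
  shows "bar_face H i (map f xs) = map f (bar_face G i xs)"
proof -
  have len: "length xs = n" and car: "set xs \<subseteq> carrier G"
    using assms(2) by (auto simp: bar_tuples_def)
  have nth: "xs ! k \<in> carrier G" if "k < n" for k
    using that len car by (metis nth_mem subsetD)
  have "f (xs ! (i - 1) \<otimes>\<^bsub>G\<^esub> xs ! i) = f (xs ! (i - 1)) \<otimes>\<^bsub>H\<^esub> f (xs ! i)" if "i < n"
    using assms(1) nth[of i] nth[of "i - 1"] that by (auto simp: hom_def)
  then show ?thesis
    using assms(3) len by (auto simp: bar_face_def map_tl map_butlast take_map drop_map)
qed

lemma bar_boundary_map:
  assumes "f \<in> hom G H" "c \<in> carrier (bar_chain_group n G)"
  shows "bar_boundary H (bar_map f c) = bar_map f (bar_boundary G c)"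
proof -
  have "Poly_Mapping.keys c \<subseteq> bar_tuples n G"
    using assms(2) by (simp add: bar_chain_group_def)
  then show ?thesis
  proof (induction c rule: frag_induction)
    case (one xs)
    then have "length xs = n" by (simp add: bar_tuples_def)
    with bar_face_map[OF assms(1) one] show ?case
      by (simp add: bar_map_simps bar_boundary_frag_of)
  qed (auto simp: bar_map_simps bar_boundary_diff)
qed

lemma bar_map_cycles:
  "\<lbrakk>f \<in> hom G H; c \<in> bar_cycles n G\<rbrakk> \<Longrightarrow> bar_map f c \<in> bar_cycles n H"
  using bar_map_in_chains[of f G H c n] bar_boundary_map[of f G H c n]
  by (auto simp: bar_cycles_def bar_map_simps)

lemma bar_map_boundaries:
  assumes "f \<in> hom G H" "b \<in> bar_boundaries n G"
  shows "bar_map f b \<in> bar_boundaries n H"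
proof -
  obtain c where c: "c \<in> carrier (bar_chain_group (Suc n) G)" "b = bar_boundary G c"
    using assms(2) by (auto simp: bar_boundaries_def)
  then show ?thesis
    using bar_boundary_map[OF assms(1) c(1)] bar_map_in_chains[OF assms(1) c(1)]
    by (auto simp: bar_boundaries_def intro!: image_eqI)
qed

lemma group_homology_map_coset:
  assumes "group G" "group H" "f \<in> hom G H" "c \<in> bar_cycles n G"
  shows "group_homology_map n H f (bar_boundaries n G #>\<^bsub>bar_cycle_group n G\<^esub> c) =
    bar_boundaries n H #>\<^bsub>bar_cycle_group n H\<^esub> bar_map f c"
proof -
  interpret H: comm_group "bar_cycle_group n H" by (rule comm_group_bar_cycle_group)
  have sub: "subgroup (bar_boundaries n H) (bar_cycle_group n H)"
    using normal_bar_boundaries[OF assms(2)] by (simp add: normal_def)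
  have z: "0 \<in> bar_boundaries n G"
    using subgroup_bar_boundaries[OF assms(1)] subgroup.one_closed by fastforce
  have "bar_boundaries n H #>\<^bsub>bar_cycle_group n H\<^esub> bar_map f (b + c) =
      bar_boundaries n H #>\<^bsub>bar_cycle_group n H\<^esub> bar_map f c" if "b \<in> bar_boundaries n G" for b
  proof -
    have "bar_map f b \<otimes>\<^bsub>bar_cycle_group n H\<^esub> bar_map f c
        \<in> bar_boundaries n H #>\<^bsub>bar_cycle_group n H\<^esub> bar_map f c"
      using bar_map_boundaries[OF assms(3) that] unfolding r_coset_def by blast
    then show ?thesis
      using H.repr_independence[OF _ _ sub] bar_map_cycles[OF assms(3,4)]
      by (simp add: bar_map_simps)
  qed
  then show ?thesis
    using z by (auto simp: group_homology_map_def r_coset_def)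
qed

lemma group_homology_map_hom:
  assumes "group G" "group H" "f \<in> hom G H"
  shows "group_homology_map n H f \<in> hom (group_homology n G) (group_homology n H)"
proof -
  interpret G: normal "bar_boundaries n G" "bar_cycle_group n G" by (rule normal_bar_boundaries) fact
  interpret H: normal "bar_boundaries n H" "bar_cycle_group n H" by (rule normal_bar_boundaries) fact
  show ?thesis
  proof (rule homI)
    fix X assume "X \<in> carrier (group_homology n G)"
    then obtain c where c: "c \<in> bar_cycles n G" "X = bar_boundaries n G #>\<^bsub>bar_cycle_group n G\<^esub> c"
      by (auto simp: group_homology_def FactGroup_def RCOSETS_def)
    then show "group_homology_map n H f X \<in> carrier (group_homology n H)"
      using bar_map_cycles[OF assms(3) c(1)]
      by (auto simp: group_homology_map_coset[OF assms] group_homology_def FactGroup_def RCOSETS_def)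
    fix Y assume "Y \<in> carrier (group_homology n G)"
    then obtain d where d: "d \<in> bar_cycles n G" "Y = bar_boundaries n G #>\<^bsub>bar_cycle_group n G\<^esub> d"
      by (auto simp: group_homology_def FactGroup_def RCOSETS_def)
    have "c + d \<in> bar_cycles n G"
      using G.m_closed c d by simp
    then show "group_homology_map n H f (X \<otimes>\<^bsub>group_homology n G\<^esub> Y) =
        group_homology_map n H f X \<otimes>\<^bsub>group_homology n H\<^esub> group_homology_map n H f Y"
      using c d bar_map_cycles[OF assms(3)] G.rcos_sum[of c d] H.rcos_sum[of "bar_map f c" "bar_map f d"]
      by (simp add: group_homology_def group_homology_map_coset[OF assms] bar_map_simps)
  qed
qed

section \<open>Universal central extensions\<close>

definition group_center :: "('a, 'm) monoid_scheme \<Rightarrow> 'a set" where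
  "group_center G = {z \<in> carrier G. \<forall>g\<in>carrier G. z \<otimes>\<^bsub>G\<^esub> g = g \<otimes>\<^bsub>G\<^esub> z}"

text \<open>\<open>1 \<rightarrow> A \<rightarrow> G \<rightarrow> Q \<rightarrow> 1\<close> is exact, with maps \<open>i\<close> and \<open>p\<close>, and \<open>i(A)\<close> is central in \<open>G\<close>.\<close>

definition central_extension ::
    "('a, 'k) monoid_scheme \<Rightarrow> ('g, 'l) monoid_scheme \<Rightarrow> ('q, 'm) monoid_scheme
      \<Rightarrow> ('a \<Rightarrow> 'g) \<Rightarrow> ('g \<Rightarrow> 'q) \<Rightarrow> bool" where
  "central_extension A G Q i p \<longleftrightarrow>
    group A \<and> group G \<and> group Q \<and> i \<in> mon A G \<and> p \<in> epi G Q \<and>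
    i ` carrier A = kernel G Q p \<and> i ` carrier A \<subseteq> group_center G"

text \<open>
  The universal property quantifies over all central extensions \<open>1 \<rightarrow> B \<rightarrow> E \<rightarrow> Q \<rightarrow> 1\<close> of \<open>Q\<close>. HOL has
  no quantification over types inside a formula, so \<open>B\<close> and \<open>E\<close> range over the groups with elements
  in \<open>'g list\<close>, where \<open>'g\<close> is the type of elements of \<open>G\<close>. This type is large enough to lose
  nothing: lemma \<open>universal_central_extension_universal\<close> derives the universal property for central
  extensions of \<open>Q\<close> by groups of arbitrary types.

  Functions are total in HOL; \<open>extensional (carrier G)\<close> fixes the irrelevant values of \<open>f\<close>
  outside \<open>carrier G\<close>, so that uniqueness is uniqueness as a homomorphism on \<open>G\<close>.
\<close>

definition universal_central_extension ::
    "('a, 'k) monoid_scheme \<Rightarrow> ('g, 'l) monoid_scheme \<Rightarrow> ('q, 'm) monoid_scheme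
      \<Rightarrow> ('a \<Rightarrow> 'g) \<Rightarrow> ('g \<Rightarrow> 'q) \<Rightarrow> bool" where
  "universal_central_extension A G Q i p \<longleftrightarrow>
    central_extension A G Q i p \<and>
    (\<forall>(B :: 'g list monoid) (E :: 'g list monoid) j q. central_extension B E Q j q \<longrightarrow>
      (\<exists>!f. f \<in> hom G E \<and> f \<in> extensional (carrier G) \<and> (\<forall>x\<in>carrier G. q (f x) = p x)))"

subsection \<open>The universal property at arbitrary types\<close>

lemma generate_lepoll:
  assumes "group E" "X \<subseteq> carrier E" "X \<lesssim> (UNIV :: 't set)" "infinite (UNIV :: 't set)"
  shows "generate E X \<lesssim> (UNIV :: 't set)"
proof -
  interpret group E by fact
  define Y where "Y = X \<union> m_inv E ` X"
  have X: "|X| \<le>o |UNIV :: 't set|"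
    using assms(3) unfolding lepoll_def card_of_ordLeq .
  then have "|m_inv E ` X| \<le>o |UNIV :: 't set|"
    using card_of_image ordLeq_transitive by blast
  with X have "|Y| \<le>o |UNIV :: 't set|"
    unfolding Y_def using assms(4) by (intro card_of_Un_ordLeq_infinite) auto
  then obtain g :: "'a \<Rightarrow> 't" where g: "inj_on g Y"
    using card_of_ordLeq[of Y "UNIV :: 't set"] by auto
  have "inj_on (map g) (lists Y)"
    using g by (intro inj_onI) (metis in_listsD inj_on_map_eq_map inj_on_subset le_sup_iff subsetI)
  then have "|lists Y| \<le>o |lists (UNIV :: 't set)|"
    using card_of_ordLeq[of "lists Y" "lists (UNIV :: 't set)"] by auto
  also have "|lists (UNIV :: 't set)| =o |UNIV :: 't set|"
    using assms(4) by (rule card_of_lists_infinite)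
  finally have lists: "|lists Y| \<le>o |UNIV :: 't set|" .
  let ?w = "\<lambda>ys. foldr (\<otimes>\<^bsub>E\<^esub>) ys \<one>\<^bsub>E\<^esub>"
  have Y: "Y \<subseteq> carrier E" using assms(2) by (auto simp: Y_def)
  have w_closed: "?w ys \<in> carrier E" if "ys \<in> lists Y" for ys
    using that Y by (induction ys) auto
  have w_append: "?w (xs @ ys) = ?w xs \<otimes>\<^bsub>E\<^esub> ?w ys" if "xs \<in> lists Y" "ys \<in> lists Y" for xs ys
    using that(1)
  proof (induction xs)
    case Nil
    then show ?case using w_closed[OF that(2)] by simp
  next
    case (Cons a xs)
    then show ?case using w_closed[OF that(2)] w_closed[of xs] Y by (auto simp: m_assoc)
  qed
  have "h \<in> ?w ` lists Y" if "h \<in> generate E X" for h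
    using that
  proof (induction rule: generate.induct)
    case one
    then show ?case by (intro image_eqI[of _ _ "[]"]) auto
  next
    case (incl h)
    then show ?case using assms(2) by (intro image_eqI[of _ _ "[h]"]) (auto simp: Y_def)
  next
    case (inv h)
    then show ?case using assms(2) by (intro image_eqI[of _ _ "[inv\<^bsub>E\<^esub> h]"]) (auto simp: Y_def)
  next
    case (eng h1 h2)
    then obtain xs ys where "xs \<in> lists Y" "ys \<in> lists Y" "h1 = ?w xs" "h2 = ?w ys" by auto
    then show ?case by (intro image_eqI[of _ _ "xs @ ys"]) (auto simp: w_append simp del: foldr_append)
  qed
  then have "|generate E X| \<le>o |?w ` lists Y|"
    by (intro card_of_mono1) auto
  from ordLeq_transitive[OF ordLeq_transitive[OF this card_of_image] lists] show ?thesis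
    unfolding lepoll_def card_of_ordLeq .
qed

text \<open>
  Every central extension of \<open>Q\<close> contains a small one through which a given small set of elements
  factors.
\<close>

lemma small_central_subextension:
  fixes X :: "'e set"
  assumes ext: "central_extension B E Q j q"
    and X: "X \<subseteq> carrier E" "q ` X = carrier Q" "X \<lesssim> (UNIV :: 't set)" "infinite (UNIV :: 't set)"
  obtains B' :: "'t monoid" and E' :: "'t monoid" and j' q' h where
    "central_extension B' E' Q j' q'" "h \<in> mon E' E" "X \<subseteq> h ` carrier E'"
    "\<And>x. x \<in> carrier E' \<Longrightarrow> q (h x) = q' x"
proof -
  have grpE: "group E" and grpQ: "group Q" and qhom: "q \<in> hom E Q" and qonto: "q ` carrier E = carrier Q"
    and ker: "kernel E Q q \<subseteq> group_center E"
    using ext by (auto simp: central_extension_def epi_def)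
  interpret E: group E by fact
  define S where "S = generate E X"
  have subS: "subgroup S E" unfolding S_def using X(1) by (rule E.generate_is_subgroup)
  then have SE: "S \<subseteq> carrier E" by (rule subgroup.subset)
  have XS: "X \<subseteq> S" unfolding S_def by (auto intro: generate.incl)
  obtain e :: "'e \<Rightarrow> 't" where inj: "inj_on e S"
    using generate_lepoll[OF grpE X(1,3,4)] by (auto simp: lepoll_def S_def)
  define ES where "ES = E\<lparr>carrier := S\<rparr>"
  have grpES: "group ES" unfolding ES_def using E.subgroup_imp_group[OF subS] .
  interpret ES: group ES by fact
  have injES: "inj_on e (carrier ES)" using inj by (simp add: ES_def)
  define E' where "E' = image_group e ES"
  have grpE': "group E'" unfolding E'_def using injES by (rule ES.inj_imp_image_group_is_group)
  interpret E': group E' by fact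
  define h where "h = inv_into (carrier ES) e"
  have iso: "h \<in> iso E' ES"
    unfolding E'_def h_def by (rule ES.iso_set_sym[OF inj_imp_image_group_iso[OF injES]])
  have hbij: "bij_betw h (carrier E') S" using iso by (auto simp: iso_def ES_def)
  then have himg: "h ` carrier E' = S" and hinj: "inj_on h (carrier E')" by (auto simp: bij_betw_def)
  have hhom: "h \<in> hom E' E" using iso SE by (auto simp: iso_def hom_def ES_def)
  have h_mult: "h (x \<otimes>\<^bsub>E'\<^esub> y) = h x \<otimes>\<^bsub>E\<^esub> h y" if "x \<in> carrier E'" "y \<in> carrier E'" for x y
    using hom_mult[OF hhom that] .
  define q' where "q' = q \<circ> h"
  have q'hom: "q' \<in> hom E' Q" unfolding q'_def using hhom qhom by (rule hom_compose)
  have "q ` S = carrier Q" using XS SE X(2) qonto by blast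
  then have q'epi: "q' \<in> epi E' Q" using q'hom himg by (auto simp: epi_def q'_def simp flip: image_image)
  interpret q': group_hom E' Q q' 
    using grpE' grpQ q'hom by (simp add: group_hom_def group_hom_axioms_def)
  define B' where "B' = E'\<lparr>carrier := kernel E' Q q'\<rparr>"
  have grpB': "group B'" unfolding B'_def using E'.subgroup_imp_group[OF q'.subgroup_kernel] .
  have "id \<in> mon B' E'" by (auto simp: mon_def hom_def B'_def kernel_def)
  moreover have "kernel E' Q q' \<subseteq> group_center E'"
  proof
    fix z assume z: "z \<in> kernel E' Q q'"
    then have zE: "z \<in> carrier E'" by (simp add: kernel_def)
    have "h z \<in> kernel E Q q" using z himg SE by (auto simp: kernel_def q'_def)
    then have c: "h z \<otimes>\<^bsub>E\<^esub> g = g \<otimes>\<^bsub>E\<^esub> h z" if "g \<in> carrier E" for g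
      using ker that by (auto simp: group_center_def)
    have "z \<otimes>\<^bsub>E'\<^esub> g = g \<otimes>\<^bsub>E'\<^esub> z" if g: "g \<in> carrier E'" for g
    proof (rule inj_onD[OF hinj])
      have "h g \<in> carrier E" using g himg SE by auto
      then show "h (z \<otimes>\<^bsub>E'\<^esub> g) = h (g \<otimes>\<^bsub>E'\<^esub> z)" using c h_mult zE g by simp
    qed (use zE g in auto)
    with zE show "z \<in> group_center E'" by (simp add: group_center_def)
  qed
  ultimately have "central_extension B' E' Q id q'"
    using grpB' grpE' grpQ q'epi by (simp add: central_extension_def B'_def)
  then show thesis
    by (rule that) (use hhom hinj himg XS in \<open>auto simp: mon_def q'_def\<close>)
qed

theorem universal_central_extension_universal:
  fixes G :: "('g, 'l) monoid_scheme" and E :: "('e, 'n) monoid_scheme"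
  assumes univ: "universal_central_extension A G Q i p" and ext: "central_extension B E Q j q"
  shows "\<exists>!f. f \<in> hom G E \<and> f \<in> extensional (carrier G) \<and> (\<forall>x\<in>carrier G. q (f x) = p x)"
proof -
  have ext0: "central_extension A G Q i p"
    and UP: "\<And>(B :: 'g list monoid) (E :: 'g list monoid) j q. central_extension B E Q j q \<Longrightarrow>
      (\<exists>!f. f \<in> hom G E \<and> f \<in> extensional (carrier G) \<and> (\<forall>x\<in>carrier G. q (f x) = p x))"
    using univ unfolding universal_central_extension_def by blast+
  have grpG: "group G" and ponto: "p ` carrier G = carrier Q"
    using ext0 by (auto simp: central_extension_def epi_def)
  have grpE: "group E" and qonto: "q ` carrier E = carrier Q"
    using ext by (auto simp: central_extension_def epi_def)
  interpret G: group G by fact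
  have inf: "infinite (UNIV :: 'g list set)" by (rule infinite_UNIV_listI)
  have small: "X \<lesssim> (UNIV :: 'g list set)" if le: "|X| \<le>o |carrier G|" for X :: "'e set"
  proof -
    obtain k where k: "inj_on k X" "k ` X \<subseteq> carrier G"
      using card_of_ordLeq[THEN iffD2, OF le] by blast
    then have "inj_on (\<lambda>x. [k x]) X" by (auto simp: inj_on_def)
    then show ?thesis unfolding lepoll_def by blast
  qed
  have ex1D: "a = b" if "\<exists>!x. P x" "P a" "P b" for P :: "('g \<Rightarrow> 'g list) \<Rightarrow> bool" and a b
    using that by blast
  have lift_eq: "f x = g x"
    if f: "f \<in> hom G E" "\<forall>x\<in>carrier G. q (f x) = p x"
      and g: "g \<in> hom G E" "\<forall>x\<in>carrier G. q (g x) = p x" and x: "x \<in> carrier G" for f g x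
  proof -
    define X where "X = f ` carrier G \<union> g ` carrier G"
    have XE: "X \<subseteq> carrier E" using f(1) g(1) by (auto simp: X_def hom_def)
    have qX: "q ` X = carrier Q"
    proof -
      have "q ` f ` carrier G = p ` carrier G" "q ` g ` carrier G = p ` carrier G"
        unfolding image_image using f(2) g(2) by (auto intro: image_cong)
      then show ?thesis by (simp add: X_def image_Un ponto)
    qed
    have "f ` carrier G \<lesssim> (UNIV :: 'g list set)" "g ` carrier G \<lesssim> (UNIV :: 'g list set)"
      by (auto intro: small)
    then have XU: "X \<lesssim> (UNIV :: 'g list set)"
      unfolding X_def lepoll_def card_of_ordLeq using inf by (intro card_of_Un_ordLeq_infinite) auto
    obtain B' :: "'g list monoid" and E' :: "'g list monoid" and j' q' h where E':
      "central_extension B' E' Q j' q'" "h \<in> mon E' E" "X \<subseteq> h ` carrier E'"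
      and q': "\<And>x. x \<in> carrier E' \<Longrightarrow> q (h x) = q' x"
      by (rule small_central_subextension[OF ext XE qX XU inf]) (rule that)
    interpret E': group E' using E'(1) by (simp add: central_extension_def)
    have hinj: "inj_on h (carrier E')" and hhom: "h \<in> hom E' E" using E'(2) by (auto simp: mon_def)
    define k where "k = inv_into (carrier E') h"
    have k: "k y \<in> carrier E'" "h (k y) = y" if "y \<in> X" for y
      using that E'(3) by (auto simp: k_def f_inv_into_f inv_into_into subset_iff)
    have lift: "restrict (k \<circ> u) (carrier G) \<in> hom G E' \<and> restrict (k \<circ> u) (carrier G) \<in> extensional (carrier G)
        \<and> (\<forall>x\<in>carrier G. q' (restrict (k \<circ> u) (carrier G) x) = p x)"
      if u: "u \<in> hom G E" "\<forall>x\<in>carrier G. q (u x) = p x" "u ` carrier G \<subseteq> X" for u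
    proof (intro conjI)
      have uX: "u x \<in> X" if "x \<in> carrier G" for x using that u(3) by auto
      show "restrict (k \<circ> u) (carrier G) \<in> hom G E'"
      proof (rule homI)
        fix x y assume xy: "x \<in> carrier G" "y \<in> carrier G"
        have "k (u (x \<otimes>\<^bsub>G\<^esub> y)) = k (u x) \<otimes>\<^bsub>E'\<^esub> k (u y)"
        proof (rule inj_onD[OF hinj])
          show "h (k (u (x \<otimes>\<^bsub>G\<^esub> y))) = h (k (u x) \<otimes>\<^bsub>E'\<^esub> k (u y))"
            using k[OF uX[OF G.m_closed[OF xy]]] k[OF uX[OF xy(1)]] k[OF uX[OF xy(2)]]
              hom_mult[OF u(1) xy] hom_mult[OF hhom, of "k (u x)" "k (u y)"] by simp
        qed (use xy k(1)[OF uX] in simp_all)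
        then show "restrict (k \<circ> u) (carrier G) (x \<otimes>\<^bsub>G\<^esub> y) =
            restrict (k \<circ> u) (carrier G) x \<otimes>\<^bsub>E'\<^esub> restrict (k \<circ> u) (carrier G) y"
          using xy by simp
      qed (use k(1)[OF uX] in simp)
      show "\<forall>x\<in>carrier G. q' (restrict (k \<circ> u) (carrier G) x) = p x"
      proof
        fix x assume x: "x \<in> carrier G"
        then show "q' (restrict (k \<circ> u) (carrier G) x) = p x"
          using q'[of "k (u x)"] k[OF uX[OF x]] u(2) by simp
      qed
    qed auto
    have fX: "f ` carrier G \<subseteq> X" and gX: "g ` carrier G \<subseteq> X" by (auto simp: X_def)
    have "restrict (k \<circ> f) (carrier G) = restrict (k \<circ> g) (carrier G)"
      by (rule ex1D[OF UP[OF E'(1)] lift[OF f fX] lift[OF g gX]])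
    from fun_cong[OF this, of x] have "k (f x) = k (g x)" using x by simp
    moreover have "f x \<in> X" "g x \<in> X" using x by (simp_all add: X_def)
    ultimately show ?thesis using k(2) by metis
  qed
  show ?thesis
  proof (rule ex_ex1I)
    define s where "s = inv_into (carrier E) q"
    define X where "X = (s \<circ> p) ` carrier G"
    have s: "s y \<in> carrier E" "q (s y) = y" if "y \<in> carrier Q" for y
      using inv_into_into[of y q "carrier E"] f_inv_into_f[of y q "carrier E"] that qonto
      by (simp_all add: s_def)
    have pQ: "p x \<in> carrier Q" if "x \<in> carrier G" for x using that ponto by auto
    have XE: "X \<subseteq> carrier E" using s pQ by (auto simp: X_def)
    have "q ` X = p ` carrier G"
      unfolding X_def image_image using s(2)[OF pQ] by (auto intro: image_cong)
    then have qX: "q ` X = carrier Q" using ponto by simp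
    have XU: "X \<lesssim> (UNIV :: 'g list set)" unfolding X_def by (auto intro: small)
    obtain B' :: "'g list monoid" and E' :: "'g list monoid" and j' q' h where E':
      "central_extension B' E' Q j' q'" "h \<in> mon E' E" "X \<subseteq> h ` carrier E'"
      and q': "\<And>x. x \<in> carrier E' \<Longrightarrow> q (h x) = q' x"
      by (rule small_central_subextension[OF ext XE qX XU inf]) (rule that)
    obtain f where f: "f \<in> hom G E'" "\<forall>x\<in>carrier G. q' (f x) = p x"
      using ex1_implies_ex[OF UP[OF E'(1)]] by blast
    have fE': "f x \<in> carrier E'" if "x \<in> carrier G" for x using f(1) that by (auto simp: hom_def)
    have "h \<in> hom E' E" using E'(2) by (simp add: mon_def)
    with f(1) have "h \<circ> f \<in> hom G E" by (rule hom_compose)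
    then have "restrict (h \<circ> f) (carrier G) \<in> hom G E" by (auto simp: hom_def)
    moreover have "\<forall>x\<in>carrier G. q (restrict (h \<circ> f) (carrier G) x) = p x"
      using f(2) q' fE' by simp
    ultimately show "\<exists>f. f \<in> hom G E \<and> f \<in> extensional (carrier G) \<and> (\<forall>x\<in>carrier G. q (f x) = p x)"
      by (intro exI[of _ "restrict (h \<circ> f) (carrier G)"] conjI restrict_extensional)
  next
    fix f g
    assume f: "f \<in> hom G E \<and> f \<in> extensional (carrier G) \<and> (\<forall>x\<in>carrier G. q (f x) = p x)"
      and g: "g \<in> hom G E \<and> g \<in> extensional (carrier G) \<and> (\<forall>x\<in>carrier G. q (g x) = p x)"
    show "f = g"
    proof (rule extensionalityI)
      show "f x = g x" if "x \<in> carrier G" for x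
        by (rule lift_eq) (use f g that in simp_all)
    qed (use f g in simp_all)
  qed
qed

end

theory Submission
  imports Defs
begin

text \<open>
  The universal property forces \<open>H\<^sub>1(G) = H\<^sub>2(G) = 0\<close> (lemmas \<open>universal_H1_trivial\<close> and
  \<open>universal_H2_trivial\<close>), and \<open>A\<close> maps into the centre \<open>Z\<close> of \<open>G\<close>. The theorem therefore follows from a
  statement about any \<open>G\<close> with vanishing \<open>H\<^sub>1\<close> and \<open>H\<^sub>2\<close>: twice a 3-cycle of the bar complex of \<open>Z\<close> is a
  boundary in the bar complex of \<open>G\<close> (lemma \<open>double_central_3_cycle\<close>).

  Vanishing of \<open>H\<^sub>1\<close> and \<open>H\<^sub>2\<close> allows one to choose 2-chains \<open>u(a)\<close> and 3-chains \<open>v(a, b)\<close> of \<open>G\<close> with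
  \<open>\<partial>u(a) = [a]\<close> and \<open>\<partial>v(a, b) = [a|b] - u(a) - u(b) + u(ab)\<close>. Then \<open>h(a, b, c) = [a|b|c] - (\<delta>v)(a, b, c)\<close>
  is a 3-cocycle on \<open>Z\<close> modulo boundaries of \<open>G\<close>, and a 3-cycle of \<open>Z\<close> is homologous in \<open>G\<close> to its value
  under \<open>h\<close>. Since \<open>Z\<close> is central, its elements can be shuffled into the chains of \<open>G\<close>, and
  \<open>c(a, b) = v(a, b) - v(b, a) + [a] * u(b)\<close> is a braiding: the pair \<open>(h, c)\<close> satisfies the hexagon
  relations, which makes it an abelian 3-cocycle of Eilenberg and MacLane. Such a pair is a class in
  \<open>H\<^sup>4(K(Z, 2))\<close>, that is, the quadratic function \<open>q(a) = c(a, a)\<close>, whose polarisation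
  \<open>c(a, b) + c(b, a)\<close> is bilinear.

  It remains to see that \<open>h\<close> is killed by 2 on \<open>H\<^sub>3(Z)\<close>. On a cyclic group \<open>\<langle>a\<rangle>\<close> the only obstruction to
  writing \<open>h\<close> as a coboundary consists of multiples of \<open>r q(a)\<close> with \<open>a\<^sup>r = 1\<close>, and
  \<open>2 r q(a) = r (c(a, a) + c(a, a)) = c(a\<^sup>r, a) + c(a, a\<^sup>r) = 0\<close> (lemma \<open>double_vanishes_on_cyclic\<close>). The
  braiding also makes \<open>h\<close> additive under products of homomorphisms (lemma \<open>additive_up_to_coboundary\<close>),
  so that a direct decomposition of \<open>Z\<close> splits the value of \<open>h\<close> on a cycle. As a cycle lives on a
  finitely generated subgroup, which is a direct product of cyclic groups, the cyclic case suffices.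
\<close>

section \<open>Splitting off a cyclic factor of a finitely generated abelian group\<close>

lemma int_shift_induct:
  fixes k :: int
  assumes "P 0" and "\<And>j. P j \<longleftrightarrow> P (j + 1)"
  shows "P k"
proof (induction k rule: int_induct[where k = 0])
  case (step2 i)
  then show ?case using assms(2)[of "i - 1"] by simp
qed (use assms in auto)

definition int_comb ::
    "('a, 'm) monoid_scheme \<Rightarrow> 'i set \<Rightarrow> ('i \<Rightarrow> 'a) \<Rightarrow> ('i \<Rightarrow> int) \<Rightarrow> 'a" where
  "int_comb K I b v = finprod K (\<lambda>i. b i [^]\<^bsub>K\<^esub> v i) I"

definition int_span :: "('a, 'm) monoid_scheme \<Rightarrow> 'i set \<Rightarrow> ('i \<Rightarrow> 'a) \<Rightarrow> 'a set" where
  "int_span K I b = range (int_comb K I b)"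

context comm_group
begin

lemma int_comb_closed [simp]: "b \<in> I \<rightarrow> carrier G \<Longrightarrow> int_comb G I b v \<in> carrier G"
  unfolding int_comb_def by (rule finprod_closed) auto

lemma int_comb_add:
  "b \<in> I \<rightarrow> carrier G \<Longrightarrow>
    int_comb G I b (\<lambda>i. v i + w i) = int_comb G I b v \<otimes> int_comb G I b w"
proof -
  assume b: "b \<in> I \<rightarrow> carrier G"
  then have "int_comb G I b (\<lambda>i. v i + w i) = finprod G (\<lambda>i. b i [^] v i \<otimes> b i [^] w i) I"
    unfolding int_comb_def by (intro finprod_cong') (auto simp: Pi_iff int_pow_mult)
  also have "\<dots> = int_comb G I b v \<otimes> int_comb G I b w"
    unfolding int_comb_def using b by (intro finprod_multf) (auto simp: Pi_iff)
  finally show ?thesis .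
qed

lemma int_comb_zero [simp]: "int_comb G I b (\<lambda>i. 0) = \<one>"
  by (simp add: int_comb_def)

lemma int_comb_diff:
  assumes "b \<in> I \<rightarrow> carrier G"
  shows "int_comb G I b (\<lambda>i. v i - w i) = int_comb G I b v \<otimes> inv (int_comb G I b w)"
  using int_comb_add[OF assms, of "\<lambda>i. v i - w i" w] assms by (simp add: m_assoc)

lemma int_comb_pow:
  assumes "b \<in> I \<rightarrow> carrier G"
  shows "int_comb G I b (\<lambda>i. k * v i) = int_comb G I b v [^] (k :: int)"
proof (induction k rule: int_shift_induct)
  case (2 j)
  have "int_comb G I b (\<lambda>i. (j + 1) * v i) = int_comb G I b (\<lambda>i. j * v i) \<otimes> int_comb G I b v"
    using int_comb_add[OF assms, of "\<lambda>i. j * v i" v] by (simp add: algebra_simps)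
  then show ?case
    using assms by (simp add: int_pow_mult)
qed simp

lemma int_comb_remove:
  "\<lbrakk>finite I; i \<in> I; b \<in> I \<rightarrow> carrier G\<rbrakk> \<Longrightarrow>
    int_comb G I b v = b i [^] v i \<otimes> int_comb G (I - {i}) b v"
  unfolding int_comb_def
  by (subst insert_Diff[symmetric, of i I]) (auto simp del: insert_Diff_single simp: finprod_insert Pi_iff)

lemma int_comb_cong:
  "\<lbrakk>b \<in> I \<rightarrow> carrier G; \<And>i. i \<in> I \<Longrightarrow> b i = b' i \<and> v i = v' i\<rbrakk> \<Longrightarrow>
    int_comb G I b v = int_comb G I b' v'"
  unfolding int_comb_def by (rule finprod_cong') (auto simp: Pi_iff)

lemma subgroup_int_span:
  assumes "b \<in> I \<rightarrow> carrier G"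
  shows "subgroup (int_span G I b) G"
proof
  show "int_span G I b \<subseteq> carrier G" using assms by (auto simp: int_span_def)
  show "\<one> \<in> int_span G I b" unfolding int_span_def using int_comb_zero by (metis rangeI)
  fix x y assume "x \<in> int_span G I b" "y \<in> int_span G I b"
  then obtain v w where vw: "x = int_comb G I b v" "y = int_comb G I b w"
    by (auto simp: int_span_def)
  then show "x \<otimes> y \<in> int_span G I b"
    using int_comb_add[OF assms, of v w] by (metis int_span_def rangeI)
  show "inv x \<in> int_span G I b"
    using int_comb_diff[OF assms, of "\<lambda>_. 0" v] vw assms
    by (metis int_span_def rangeI int_comb_zero int_comb_closed inv_closed l_one)
qed

text \<open>
  Adding to the generator \<open>b i\<close> a combination of the other generators is an invertible change of
  coordinates.
\<close>

lemma int_comb_update: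
  fixes q :: "'i \<Rightarrow> int"
  assumes "finite I" "i \<in> I" "b \<in> I \<rightarrow> carrier G"
  shows "int_comb G I (b(i := b i \<otimes> int_comb G (I - {i}) b q)) w =
    int_comb G I b (\<lambda>j. if j = i then w i else w j + w i * q j)"
    (is "int_comb G I ?b' w = int_comb G I b ?w'")
proof -
  have b': "?b' \<in> I \<rightarrow> carrier G" and bi: "b \<in> I - {i} \<rightarrow> carrier G" "b i \<in> carrier G"
    using assms by (auto simp: Pi_iff)
  have "int_comb G I ?b' w = ?b' i [^] w i \<otimes> int_comb G (I - {i}) ?b' w"
    using assms(1,2) b' by (rule int_comb_remove)
  also have "int_comb G (I - {i}) ?b' w = int_comb G (I - {i}) b w"
    using bi b' by (intro int_comb_cong) auto
  also have "?b' i [^] w i = b i [^] w i \<otimes> int_comb G (I - {i}) b (\<lambda>j. w i * q j)"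
    using bi by (simp add: int_pow_distrib int_comb_pow)
  also have "b i [^] w i \<otimes> int_comb G (I - {i}) b (\<lambda>j. w i * q j) \<otimes> int_comb G (I - {i}) b w =
      b i [^] w i \<otimes> int_comb G (I - {i}) b (\<lambda>j. w j + w i * q j)"
    using bi by (simp add: int_comb_add m_ac)
  also have "int_comb G (I - {i}) b (\<lambda>j. w j + w i * q j) = int_comb G (I - {i}) b ?w'"
    using bi by (intro int_comb_cong) auto
  also have "b i [^] w i \<otimes> int_comb G (I - {i}) b ?w' = int_comb G I b ?w'"
    using int_comb_remove[OF assms, of ?w'] by simp
  finally show ?thesis .
qed

lemma int_span_update:
  fixes q :: "'i \<Rightarrow> int"
  assumes "finite I" "i \<in> I" "b \<in> I \<rightarrow> carrier G"
  shows "int_span G I (b(i := b i \<otimes> int_comb G (I - {i}) b q)) = int_span G I b"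
proof
  show "int_span G I (b(i := b i \<otimes> int_comb G (I - {i}) b q)) \<subseteq> int_span G I b"
    unfolding int_span_def int_comb_update[OF assms] by auto
  have "int_comb G I b v = int_comb G I (b(i := b i \<otimes> int_comb G (I - {i}) b q))
      (\<lambda>j. if j = i then v i else v j - v i * q j)" for v
    unfolding int_comb_update[OF assms] using assms(3) by (intro int_comb_cong) auto
  then show "int_span G I b \<subseteq> int_span G I (b(i := b i \<otimes> int_comb G (I - {i}) b q))"
    unfolding int_span_def by auto
qed

text \<open>
  Euclid's algorithm on relations: among all nonzero coefficients that occur in relations between
  \<open>card I\<close> generators of the group choose one, \<open>d\<close>, of least absolute value. Its remainders vanish, so
  that \<open>d\<close> divides the other coefficients of its relation, and a change of generators turns the
  relation into \<open>b\<^sub>i\<^sup>d = 1\<close>; in every other relation \<open>d\<close> divides the \<open>i\<close>-th coefficient. (If there are no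
  nonzero coefficients, then the generators are independent, and any of them will do.) The conclusion says
  that the group is the direct product of \<open>\<langle>b\<^sub>i\<rangle>\<close> and the span of the remaining generators.
\<close>

lemma exists_splitting_generator:
  fixes a :: "'i \<Rightarrow> 'a"
  assumes fin: "finite I" and ne: "I \<noteq> {}" and a: "a \<in> I \<rightarrow> carrier G"
  obtains b i where "b \<in> I \<rightarrow> carrier G" "i \<in> I" "int_span G I b = int_span G I a"
    "\<And>v. int_comb G I b v = \<one> \<Longrightarrow> b i [^] v i = \<one>"
proof (cases "\<forall>v. int_comb G I a v = \<one> \<longrightarrow> (\<forall>i\<in>I. v i = 0)")
  case True
  obtain i where i: "i \<in> I" using ne by blast
  have "a i [^] v i = \<one>" if "int_comb G I a v = \<one>" for v
  proof -
    have "v i = 0" using True that i by blast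
    then show ?thesis by simp
  qed
  with a i show ?thesis by (intro that) auto
next
  case False
  define R where "R = (\<lambda>(b, v, i). b \<in> I \<rightarrow> carrier G \<and> i \<in> I \<and> int_span G I b = int_span G I a
    \<and> int_comb G I b v = \<one> \<and> (v i :: int) \<noteq> 0)"
  define m where "m = (\<lambda>(b :: 'i \<Rightarrow> 'a, v, i :: 'i). nat \<bar>v i :: int\<bar>)"
  from False obtain v0 i0 where "int_comb G I a v0 = \<one>" "i0 \<in> I" "v0 i0 \<noteq> 0" by blast
  with a have "R (a, v0, i0)" by (simp add: R_def)
  then have "\<exists>t. R t \<and> (\<forall>s. R s \<longrightarrow> m t \<le> m s)" by (rule ex_has_least_nat)
  then obtain t where t: "R t" "\<And>s. R s \<Longrightarrow> m t \<le> m s" by blast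
  obtain b v i where t_eq: "t = (b, v, i)" by (cases t)
  have b: "b \<in> I \<rightarrow> carrier G" and i: "i \<in> I" and span: "int_span G I b = int_span G I a"
    and rel: "int_comb G I b v = \<one>" and nz: "v i \<noteq> 0"
    using t(1) by (auto simp: R_def t_eq)
  define d where "d = v i"
  define b' where "b' = b(i := b i \<otimes> int_comb G (I - {i}) b (\<lambda>j. v j div d))"
  have b': "b' \<in> I \<rightarrow> carrier G" using b i by (auto simp: b'_def Pi_iff)
  have span': "int_span G I b' = int_span G I a"
    unfolding b'_def int_span_update[OF fin i b] by (rule span)
  have b'i: "b' i \<in> carrier G" using b' i by auto
  \<comment> \<open>Minimality is used for the new generators, which span the same group.\<close>
  have minimal: "w j = 0" if "int_comb G I b' w = \<one>" "j \<in> I" "\<bar>w j\<bar> < \<bar>d\<bar>" for w j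
  proof (rule ccontr)
    assume "w j \<noteq> 0"
    with that b' span' have "R (b', w, j)" by (simp add: R_def)
    from t(2)[OF this] that(3) show False by (simp add: m_def t_eq d_def)
  qed
  define s where "s = (\<lambda>j. if j = i then d else v j mod d)"
  have "int_comb G I b' s = int_comb G I b (\<lambda>j. if j = i then s i else s j + s i * (v j div d))"
    unfolding b'_def by (rule int_comb_update[OF fin i b])
  also have "(\<lambda>j. if j = i then s i else s j + s i * (v j div d)) = v"
  proof
    fix j
    show "(if j = i then s i else s j + s i * (v j div d)) = v j"
      using mod_mult_div_eq[of "v j" d] by (cases "j = i") (simp_all only: s_def d_def if_True if_False simp_thms)
  qed
  finally have rel': "int_comb G I b' s = \<one>" using rel by simp
  have "s j = 0" if "j \<in> I - {i}" for j
    using minimal[OF rel', of j] that nz by (simp add: s_def d_def abs_mod_less)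
  then have "int_comb G (I - {i}) b' s = int_comb G (I - {i}) b' (\<lambda>j. 0)"
    using b' by (intro int_comb_cong) auto
  also have "\<dots> = \<one>" by (rule int_comb_zero)
  finally have ord: "b' i [^] d = \<one>"
    using rel' int_comb_remove[OF fin i b'] b'i by (simp add: s_def)
  have red: "b' i [^] (w mod d) = b' i [^] w" for w
  proof -
    have "b' i [^] w = b' i [^] (d * (w div d)) \<otimes> b' i [^] (w mod d)"
      using b'i by (simp flip: int_pow_mult)
    then show ?thesis using b'i ord by (simp flip: int_pow_pow)
  qed
  have "b' i [^] w i = \<one>" if "int_comb G I b' w = \<one>" for w
  proof -
    have "int_comb G (I - {i}) b' (w(i := w i mod d)) = int_comb G (I - {i}) b' w"
      using b' by (intro int_comb_cong) auto
    then have "int_comb G I b' (w(i := w i mod d)) = int_comb G I b' w"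
      using int_comb_remove[OF fin i b'] red by simp
    then have "w i mod d = 0"
      using minimal[of "w(i := w i mod d)" i] that i nz by (simp add: d_def abs_mod_less)
    then show ?thesis using red[of "w i"] by simp
  qed
  with b' i span' show ?thesis by (rule that)
qed

end

section \<open>Cochains with values in chains modulo relations\<close>

lemma bar_boundary_simps:
  "bar_boundary G (frag_of [a]) = 0"
  "bar_boundary G (frag_of [a, b]) = frag_of [b] - frag_of [a \<otimes>\<^bsub>G\<^esub> b] + frag_of [a]"
  "bar_boundary G (frag_of [a, b, c]) =
    frag_of [b, c] - frag_of [a \<otimes>\<^bsub>G\<^esub> b, c] + frag_of [a, b \<otimes>\<^bsub>G\<^esub> c] - frag_of [a, b]"
  "bar_boundary G (frag_of [a, b, c, d]) =
    frag_of [b, c, d] - frag_of [a \<otimes>\<^bsub>G\<^esub> b, c, d] + frag_of [a, b \<otimes>\<^bsub>G\<^esub> c, d]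
      - frag_of [a, b, c \<otimes>\<^bsub>G\<^esub> d] + frag_of [a, b, c]"
  by (simp_all add: bar_boundary_frag_of bar_face_def eval_nat_numeral algebra_simps)

text \<open>
  The discrete integral \<open>\<integral>\<^sub>0\<^sup>j F\<close>, with the sign of an oriented integral for negative \<open>j\<close>, so that the
  difference equation \<open>int_sum_Suc\<close> holds on all integers.
\<close>

definition int_sum :: "(int \<Rightarrow> 'b::ab_group_add) \<Rightarrow> int \<Rightarrow> 'b" where
  "int_sum F j = sum F {0..<j} - sum F {j..<0}"

lemma int_sum_0 [simp]: "int_sum F 0 = 0"
  by (simp add: int_sum_def)

lemma int_sum_Suc: "int_sum F (j + 1) = int_sum F j + F j"
proof (cases "0 \<le> j")
  case True
  then have "{0..<j + 1} = insert j {0..<j}" by auto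
  then show ?thesis using True by (simp add: int_sum_def)
next
  case False
  then have "{j..<0} = insert j {j + 1..<0}" by auto
  then show ?thesis using False by (simp add: int_sum_def)
qed

lemma bar_boundary_carrier_update [simp]: "bar_boundary (K\<lparr>carrier := C\<rparr>) = bar_boundary K"
proof -
  have "bar_face (K\<lparr>carrier := C\<rparr>) i xs = bar_face K i xs" for i xs
    by (simp add: bar_face_def)
  then show ?thesis unfolding bar_boundary_def by presburger
qed

text \<open>
  The coefficient group of the cocycles is the quotient of a group of chains by a subgroup \<open>N\<close> (below
  the boundaries). Equality in this quotient is written as membership of the difference in \<open>N\<close>, which
  keeps all computations in the additive group of chains.
\<close>

locale chain_relations =
  fixes N :: "('c \<Rightarrow>\<^sub>0 int) set"
  assumes N_zero [simp]: "0 \<in> N"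
    and N_diff: "\<lbrakk>x \<in> N; y \<in> N\<rbrakk> \<Longrightarrow> x - y \<in> N"
begin

lemma N_minus: "x \<in> N \<Longrightarrow> - x \<in> N"
  using N_diff[of 0 x] by simp

lemma N_add: "\<lbrakk>x \<in> N; y \<in> N\<rbrakk> \<Longrightarrow> x + y \<in> N"
  using N_diff[of x "- y"] N_minus[of y] by simp

lemma N_cong: "x - y \<in> N \<Longrightarrow> x \<in> N \<longleftrightarrow> y \<in> N"
  using N_add[of "x - y" y] N_diff[of x "x - y"] by auto

text \<open>
  Evaluating \<open>\<delta>g\<close> on a chain is evaluating \<open>g\<close> on its boundary.
\<close>

lemma coboundary_vanishes_on_cycles:
  assumes cyc: "X \<in> bar_cycles 3 (K\<lparr>carrier := C\<rparr>)"
    and cob: "\<And>x y z. \<lbrakk>x \<in> C; y \<in> C; z \<in> C\<rbrakk> \<Longrightarrow>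
      \<phi> x y z - (g y z - g (x \<otimes>\<^bsub>K\<^esub> y) z + g x (y \<otimes>\<^bsub>K\<^esub> z) - g x y) \<in> N"
  shows "frag_extend (\<lambda>xs. \<phi> (xs ! 0) (xs ! 1) (xs ! 2)) X \<in> N"
proof -
  let ?\<phi> = "frag_extend (\<lambda>xs. \<phi> (xs ! 0) (xs ! 1) (xs ! 2))"
  let ?g = "frag_extend (\<lambda>xs. g (xs ! 0) (xs ! 1))"
  have keys: "Poly_Mapping.keys X \<subseteq> bar_tuples 3 (K\<lparr>carrier := C\<rparr>)" and bd: "bar_boundary K X = 0"
    using cyc by (auto simp: bar_cycles_def bar_chain_group_def)
  from keys have "?\<phi> X - ?g (bar_boundary K X) \<in> N"
  proof (induction X rule: frag_induction)
    case (one xs)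
    then obtain x y z where xs: "xs = [x, y, z]" "x \<in> C" "y \<in> C" "z \<in> C"
      by (auto simp: bar_tuples_def eval_nat_numeral length_Suc_conv)
    then show ?case
      using cob[of x y z] by (simp add: bar_boundary_simps frag_extend_add frag_extend_diff)
  next
    case (diff a b)
    then show ?case
      using N_diff[OF diff] by (simp add: bar_boundary_diff frag_extend_diff algebra_simps)
  qed simp
  then show ?thesis by (simp add: bd)
qed

end

lemma generator_in_chains:
  "set xs \<subseteq> carrier G \<Longrightarrow> length xs = n \<Longrightarrow> frag_of xs \<in> carrier (bar_chain_group n G)"
  by (simp add: bar_chain_group_def bar_tuples_def)

lemma boundary_in_boundaries:
  "w \<in> carrier (bar_chain_group (Suc n) G) \<Longrightarrow> bar_boundary G w \<in> bar_boundaries n G"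
  by (simp add: bar_boundaries_def)

lemma bar_boundaries_chain_relations:
  assumes "group G"
  shows "chain_relations (bar_boundaries n G)"
proof
  have sub: "subgroup (bar_boundaries n G) (bar_chain_group n G)" by (rule subgroup_bar_boundaries[OF assms])
  show "0 \<in> bar_boundaries n G" using subgroup.one_closed[OF sub] by simp
  show "x - y \<in> bar_boundaries n G" if "x \<in> bar_boundaries n G" "y \<in> bar_boundaries n G" for x y
    using that unfolding bar_boundaries_def
    by (auto simp flip: bar_boundary_diff intro!: imageI bar_chains_diff)
qed

section \<open>Abelian 3-cocycles\<close>

text \<open>
  Abelian 3-cocycles of Eilenberg and MacLane, that is, the associator \<open>h\<close> and braiding \<open>c\<close> of a braided
  categorical group. The second hexagon relation is stated as bilinearity of the symmetrised braiding:
  the first argument of \<open>c\<close> then obeys the mirror image of the relation \<open>hexagon\<close> for the second.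
\<close>

locale abelian_cocycle = comm_group K + chain_relations N
  for K :: "('a, 'm) monoid_scheme" (structure) and N :: "('c \<Rightarrow>\<^sub>0 int) set" +
  fixes h :: "'a \<Rightarrow> 'a \<Rightarrow> 'a \<Rightarrow> ('c \<Rightarrow>\<^sub>0 int)" and c :: "'a \<Rightarrow> 'a \<Rightarrow> ('c \<Rightarrow>\<^sub>0 int)"
  assumes cocycle: "\<lbrakk>x \<in> carrier K; y \<in> carrier K; z \<in> carrier K; w \<in> carrier K\<rbrakk> \<Longrightarrow>
      h y z w - h (x \<otimes> y) z w + h x (y \<otimes> z) w - h x y (z \<otimes> w) + h x y z \<in> N"
    and hexagon: "\<lbrakk>x \<in> carrier K; y \<in> carrier K; z \<in> carrier K\<rbrakk> \<Longrightarrow>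
      h x y z - h y x z + h y z x - (c x y + c x z - c x (y \<otimes> z)) \<in> N"
    and symmetrised_bilinear: "\<lbrakk>x \<in> carrier K; y \<in> carrier K; z \<in> carrier K\<rbrakk> \<Longrightarrow>
      (c (x \<otimes> y) z + c z (x \<otimes> y)) - (c x z + c z x) - (c y z + c z y) \<in> N"
begin

abbreviation h_eval :: "('a list \<Rightarrow>\<^sub>0 int) \<Rightarrow> ('c \<Rightarrow>\<^sub>0 int)" where
  "h_eval \<equiv> frag_extend (\<lambda>xs. h (xs ! 0) (xs ! 1) (xs ! 2))"

text \<open>
  On the integers, \<open>h\<close> pulled back along \<open>k \<mapsto> a\<^sup>k\<close> is the coboundary of \<open>- S\<close>, the negative of the discrete
  integral \<open>S j w = \<Sum>\<^sub>0\<^sub>\<le>\<^sub>t\<^sub><\<^sub>j h(a, a\<^sup>t, w)\<close>, up to a correction that accounts for \<open>h\<close> not being normalised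
  at \<open>1\<close>. Choosing logarithms \<open>\<rho>\<close>, the same cochain on \<open>\<langle>a\<rangle>\<close> leaves as error the period \<open>S r w\<close>, where
  \<open>r = \<rho> x + \<rho> y - \<rho> (x y)\<close> is a carry, so that \<open>a\<^sup>r = 1\<close>. Periods are additive in \<open>w\<close>, hence multiples of
  \<open>S r a\<close>. By the hexagon relation for \<open>(a; a\<^sup>t, a)\<close> the sum \<open>S r a\<close> telescopes to \<open>r c(a, a)\<close>, and twice
  this is \<open>D(a\<^sup>r, a) = D(1, a) = 0\<close> for the bilinear form \<open>D(x, y) = c(x, y) + c(y, x)\<close>.
\<close>

lemma double_vanishes_on_cyclic:
  assumes a: "a \<in> carrier K"
    and X: "X \<in> bar_cycles 3 (K\<lparr>carrier := range (\<lambda>k::int. a [^] k)\<rparr>)"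
  shows "h_eval X + h_eval X \<in> N"
proof -
  define e where "e = (\<lambda>k::int. a [^] k)"
  have e [simp]: "e k \<in> carrier K" for k using a by (simp add: e_def)
  have e_add: "e i \<otimes> e j = e (i + j)" for i j using a by (simp add: e_def int_pow_mult)
  have e0: "e 0 = \<one>" and e1: "e 1 = a" using a by (simp_all add: e_def)
  have a_e: "a \<otimes> e j = e (j + 1)" and e_a: "e j \<otimes> a = e (j + 1)" for j
    using e_add[of 1 j] e_add[of j 1] by (simp_all add: e1 add.commute)
  define S where "S = (\<lambda>j w. int_sum (\<lambda>t. h a (e t) w) j)"
  have S0: "S 0 w = 0" and S_Suc: "S (j + 1) w = S j w + h a (e j) w" for j w
    by (simp_all add: S_def int_sum_Suc)
  have h_one: "h \<one> z w - (h \<one> \<one> (z \<otimes> w) - h \<one> \<one> z) \<in> N" if "z \<in> carrier K" "w \<in> carrier K" for z w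
    using cocycle[of \<one> \<one> z w] that by (simp add: algebra_simps)
  \<comment> \<open>Both sides satisfy the same recursion in \<open>i\<close>, by the cocycle relation for \<open>a, a\<^sup>i, a\<^sup>j, w\<close>.\<close>
  have h_S: "h (e i) (e j) w - (S (i + j) w - S j w - S i (e j \<otimes> w) + S i (e j)
      + h \<one> \<one> (e j \<otimes> w) - h \<one> \<one> (e j)) \<in> N" if w: "w \<in> carrier K" for i j w
  proof (induction i rule: int_shift_induct)
    case 1
    then show ?case using h_one[of "e j" w] w by (simp add: S0 e0 algebra_simps)
  next
    case (2 i)
    show ?case
    proof (rule N_cong)
      have *: "i + 1 + j = (i + j) + 1" by simp
      show "h (e i) (e j) w - (S (i + j) w - S j w - S i (e j \<otimes> w) + S i (e j)
          + h \<one> \<one> (e j \<otimes> w) - h \<one> \<one> (e j))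
        - (h (e (i + 1)) (e j) w - (S (i + 1 + j) w - S j w - S (i + 1) (e j \<otimes> w) + S (i + 1) (e j)
          + h \<one> \<one> (e j \<otimes> w) - h \<one> \<one> (e j))) \<in> N"
        using cocycle[of a "e i" "e j" w] a w unfolding * S_Suc by (simp add: a_e e_add algebra_simps)
    qed
  qed
  have S_period: "S (j + r) w = S j w + S r w" if "e r = \<one>" for j r w
  proof (induction j rule: int_shift_induct)
    case (2 j)
    have *: "j + 1 + r = (j + r) + 1" by simp
    have "e (j + r) = e j" using e_add[of j r] that by simp
    then show ?case unfolding * S_Suc by (simp add: algebra_simps)
  qed (simp add: S0)
  \<comment> \<open>For \<open>i = r\<close> the left-hand side of \<open>h_S\<close> is \<open>h 1 (e l) w\<close>, which cancels the correction at \<open>1\<close>.\<close>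
  have S_additive: "S r (e l \<otimes> w) - S r (e l) - S r w \<in> N" if r: "e r = \<one>" and w: "w \<in> carrier K" for r l w
  proof -
    have "S r (e l \<otimes> w) - S r (e l) - S r w =
      (h (e r) (e l) w - (S (r + l) w - S l w - S r (e l \<otimes> w) + S r (e l)
        + h \<one> \<one> (e l \<otimes> w) - h \<one> \<one> (e l)))
      - (h \<one> (e l) w - (h \<one> \<one> (e l \<otimes> w) - h \<one> \<one> (e l)))"
      using S_period[OF r, of l w] r by (simp add: add.commute[of r] algebra_simps)
    then show ?thesis using N_diff[OF h_S[OF w, of r l] h_one[OF e w, of l]] by (simp only:)
  qed
  have S_a: "S j a - (c a \<one> - c a (e j) + frag_cmul j (c a a)) \<in> N" for j
  proof (induction j rule: int_shift_induct)
    case (2 j)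
    show ?case
    proof (rule N_cong)
      show "S j a - (c a \<one> - c a (e j) + frag_cmul j (c a a))
        - (S (j + 1) a - (c a \<one> - c a (e (j + 1)) + frag_cmul (j + 1) (c a a))) \<in> N"
        using N_minus[OF hexagon[of a "e j" a]] a
        unfolding S_Suc frag_cmul_distrib by (simp add: e_a algebra_simps)
    qed
  qed (simp add: S0 e0)
  define D where "D = (\<lambda>x y. c x y + c y x)"
  have D_add: "D (x \<otimes> y) z - D x z - D y z \<in> N"
    if "x \<in> carrier K" "y \<in> carrier K" "z \<in> carrier K" for x y z
    using symmetrised_bilinear[OF that] by (simp add: D_def)
  have D_one: "D \<one> a \<in> N"
    using N_minus[OF D_add[of \<one> \<one> a]] a by simp
  have D_pow: "frag_cmul j (D a a) - D (e j) a \<in> N" for j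
  proof (induction j rule: int_shift_induct)
    case 1
    then show ?case using N_minus[OF D_one] by (simp add: e0)
  next
    case (2 j)
    show ?case
    proof (rule N_cong)
      show "frag_cmul j (D a a) - D (e j) a - (frag_cmul (j + 1) (D a a) - D (e (j + 1)) a) \<in> N"
        using D_add[of "e j" a a] a unfolding frag_cmul_distrib by (simp add: e_a algebra_simps)
    qed
  qed
  have double_S_a: "S r a + S r a \<in> N" if r: "e r = \<one>" for r
  proof -
    let ?s = "S r a - (c a \<one> - c a (e r) + frag_cmul r (c a a))"
    have "S r a + S r a = ?s + ?s + (frag_cmul r (D a a) - D (e r) a) + D \<one> a"
      using r by (simp add: D_def frag_cmul_distrib2 algebra_simps)
    also have "\<dots> \<in> N" by (intro N_add S_a D_pow D_one)
    finally show ?thesis .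
  qed
  have double_S: "S r (e l) + S r (e l) \<in> N" if r: "e r = \<one>" for r l
  proof (induction l rule: int_shift_induct)
    case 1
    have "- S r (e 0) \<in> N" using S_additive[OF r, of \<one> 0] by (simp add: e0)
    then show ?case using N_minus[of "- S r (e 0)"] by (simp add: N_add)
  next
    case (2 l)
    show ?case
    proof (rule N_cong)
      let ?s = "S r (e l \<otimes> a) - S r (e l) - S r a"
      have "S r (e l) + S r (e l) - (S r (e (l + 1)) + S r (e (l + 1))) = - (?s + ?s) - (S r a + S r a)"
        by (simp add: e_a algebra_simps)
      also have "\<dots> \<in> N"
        by (intro N_diff N_minus N_add S_additive[OF r a] double_S_a[OF r])
      finally show "S r (e l) + S r (e l) - (S r (e (l + 1)) + S r (e (l + 1))) \<in> N" .
    qed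
  qed
  define \<rho> where "\<rho> = inv_into UNIV e"
  define g where "g = (\<lambda>y z. h \<one> \<one> z - S (\<rho> y) z)"
  have "frag_extend (\<lambda>xs. h (xs ! 0) (xs ! 1) (xs ! 2) + h (xs ! 0) (xs ! 1) (xs ! 2)) X \<in> N"
  proof (rule coboundary_vanishes_on_cycles[where \<phi> = "\<lambda>x y z. h x y z + h x y z"
        and g = "\<lambda>y z. g y z + g y z", OF X[folded e_def]])
    fix x y z
    assume range: "x \<in> range e" "y \<in> range e" "z \<in> range e"
    define i j where "i = \<rho> x" and "j = \<rho> y"
    have x: "x = e i" and y: "y = e j"
      using f_inv_into_f[OF range(1)] f_inv_into_f[OF range(2)] by (simp_all add: i_def j_def \<rho>_def)
    obtain l where z: "z = e l" using range(3) by auto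
    define m where "m = \<rho> (x \<otimes> y)"
    have "e m = e (i + j)"
      using f_inv_into_f[of "x \<otimes> y" e UNIV] by (simp add: m_def \<rho>_def x y e_add)
    then have r: "e (i + j - m) = \<one>"
      using e_add[of "i + j - m" m] e by (metis diff_add_cancel l_cancel_one' r_cancel_one')
    have per: "S (i + j) z = S m z + S (i + j - m) z"
      using S_period[OF r, of m z] by simp
    let ?u = "h x y z - (S (i + j) z - S j z - S i (y \<otimes> z) + S i y + h \<one> \<one> (y \<otimes> z) - h \<one> \<one> y)"
    have u: "?u \<in> N" using h_S[of z i j] by (simp add: x y z)
    have "h x y z + h x y z - ((g y z + g y z) - (g (x \<otimes> y) z + g (x \<otimes> y) z)
        + (g x (y \<otimes> z) + g x (y \<otimes> z)) - (g x y + g x y)) =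
      ?u + ?u + (S (i + j - m) z + S (i + j - m) z)"
      unfolding g_def i_def[symmetric] j_def[symmetric] m_def[symmetric] per by (simp add: algebra_simps)
    also have "\<dots> \<in> N" unfolding z by (intro N_add u[unfolded z] double_S[OF r])
    finally show "h x y z + h x y z - (g y z + g y z - (g (x \<otimes> y) z + g (x \<otimes> y) z)
        + (g x (y \<otimes> z) + g x (y \<otimes> z)) - (g x y + g x y)) \<in> N" .
  qed
  then show ?thesis
    by (simp add: frag_extend_def frag_cmul_distrib2 sum.distrib)
qed

text \<open>
  Additivity of \<open>h\<close> on products of pairs. In a braided categorical group, \<open>k\<close> is the interchange
  isomorphism \<open>(x \<otimes> x') \<otimes> (y \<otimes> y') \<rightarrow> (x \<otimes> y) \<otimes> (x' \<otimes> y')\<close>, composed of four associators and the braiding of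
  \<open>x'\<close> past \<open>y\<close> and their inverses; the lemma is the coherence that makes the tensor product a monoidal
  functor. The relations between associators that enter form the chain homotopy between the identity
  and the composite of the Alexander-Whitney and shuffle maps, pushed forward along the multiplication.
\<close>

lemma additive_up_to_coboundary:
  assumes [simp]: "x \<in> carrier K" "y \<in> carrier K" "z \<in> carrier K"
    "x' \<in> carrier K" "y' \<in> carrier K" "z' \<in> carrier K"
  defines "k \<equiv> \<lambda>x x' y y'. h x' y y' - h x x' (y \<otimes> y') - h y x' y' + h x y (x' \<otimes> y') - c x' y"
  shows "h (x \<otimes> x') (y \<otimes> y') (z \<otimes> z') - h x y z - h x' y' z'
    - (k y y' z z' - k (x \<otimes> y) (x' \<otimes> y') z z' + k x x' (y \<otimes> z) (y' \<otimes> z') - k x x' y y') \<in> N"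
proof -
  define \<delta> where "\<delta> = (\<lambda>x y z w. h y z w - h (x \<otimes> y) z w + h x (y \<otimes> z) w - h x y (z \<otimes> w) + h x y z)"
  have \<delta>: "\<delta> a b c d \<in> N" if "a \<in> carrier K" "b \<in> carrier K" "c \<in> carrier K" "d \<in> carrier K" for a b c d
    unfolding \<delta>_def by (rule cocycle) fact+
  \<comment> \<open>Relations for 4-tuples that interleave the unprimed and the primed letters, each in its order:\<close>
  \<comment> \<open>\<open>?A\<close> and \<open>?B\<close> collect the terms of this homotopy with positive and negative sign. The hexagons\<close>
  \<comment> \<open>\<open>?C\<close> evaluate the two mixed shuffles, and \<open>?D\<close> exchanges the arguments of \<open>c\<close> in the second one.\<close>
  let ?A = "\<delta> y x' z (y' \<otimes> z') + \<delta> x' z y' z' + \<delta> x' y y' (z \<otimes> z') + \<delta> x y (x' \<otimes> y') (z \<otimes> z')"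
  let ?B = "\<delta> z x' y' z' + \<delta> y z x' (y' \<otimes> z') + \<delta> x' y' z z' + \<delta> x x' (y \<otimes> y') (z \<otimes> z')
    + \<delta> y x' y' (z \<otimes> z') + \<delta> x' y z (y' \<otimes> z') + \<delta> x y z (x' \<otimes> (y' \<otimes> z'))"
  let ?C = "h x' y z - h y x' z + h y z x' - (c x' y + c x' z - c x' (y \<otimes> z))
    + (h z x' y' - h x' z y' + h x' y' z - (c z x' + c z y' - c z (x' \<otimes> y')))"
  let ?D = "(c (x' \<otimes> y') z + c z (x' \<otimes> y')) - (c x' z + c z x') - (c y' z + c z y')"
  have "h (x \<otimes> x') (y \<otimes> y') (z \<otimes> z') - h x y z - h x' y' z'
    - (k y y' z z' - k (x \<otimes> y) (x' \<otimes> y') z z' + k x x' (y \<otimes> z) (y' \<otimes> z') - k x x' y y')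
    = ?A - ?B + ?C - ?D"
    unfolding \<delta>_def k_def by (simp add: m_ac algebra_simps)
  also have "\<dots> \<in> N"
    by (intro N_diff N_add \<delta> hexagon symmetrised_bilinear m_closed assms(1-6))
  finally show ?thesis .
qed

lemma h_eval_split:
  assumes C: "C \<subseteq> carrier K" and X: "X \<in> bar_cycles 3 (K\<lparr>carrier := C\<rparr>)"
    and f: "f \<in> hom (K\<lparr>carrier := C\<rparr>) K" and f': "f' \<in> hom (K\<lparr>carrier := C\<rparr>) K"
    and split: "\<And>y. y \<in> C \<Longrightarrow> f y \<otimes> f' y = y"
    and closed: "\<And>x y. \<lbrakk>x \<in> C; y \<in> C\<rbrakk> \<Longrightarrow> x \<otimes> y \<in> C"
  shows "h_eval X - (h_eval (bar_map f X) + h_eval (bar_map f' X)) \<in> N"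
proof -
  define \<phi> where "\<phi> = (\<lambda>x y z. h x y z - h (f x) (f y) (f z) - h (f' x) (f' y) (f' z))"
  have fC: "f x \<in> carrier K" "f' x \<in> carrier K" if "x \<in> C" for x
    using f f' that by (auto simp: hom_def)
  have fm: "f (x \<otimes> y) = f x \<otimes> f y" "f' (x \<otimes> y) = f' x \<otimes> f' y" if "x \<in> C" "y \<in> C" for x y
    using f f' that by (auto simp: hom_def)
  have "frag_extend (\<lambda>xs. \<phi> (xs ! 0) (xs ! 1) (xs ! 2)) X \<in> N"
  proof (rule coboundary_vanishes_on_cycles[OF X])
    let ?k = "\<lambda>x y. h (f' x) (f y) (f' y) - h (f x) (f' x) (f y \<otimes> f' y) - h (f y) (f' x) (f' y)
      + h (f x) (f y) (f' x \<otimes> f' y) - c (f' x) (f y)"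
    fix x y z assume *: "x \<in> C" "y \<in> C" "z \<in> C"
    show "\<phi> x y z - (?k y z - ?k (x \<otimes> y) z + ?k x (y \<otimes> z) - ?k x y) \<in> N"
      using additive_up_to_coboundary[of "f x" "f y" "f z" "f' x" "f' y" "f' z"] *
      by (simp add: \<phi>_def fC fm split closed)
  qed
  also have "frag_extend (\<lambda>xs. \<phi> (xs ! 0) (xs ! 1) (xs ! 2)) X =
      h_eval X - h_eval (bar_map f X) - h_eval (bar_map f' X)"
  proof -
    have "Poly_Mapping.keys X \<subseteq> bar_tuples 3 (K\<lparr>carrier := C\<rparr>)"
      using X by (auto simp: bar_cycles_def bar_chain_group_def)
    then show ?thesis
    proof (induction X rule: frag_induction)
      case (one xs)
      then show ?case by (simp add: bar_tuples_def bar_map_simps \<phi>_def)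
    qed (simp_all add: frag_extend_diff bar_map_simps)
  qed
  finally show ?thesis by (simp add: algebra_simps)
qed

text \<open>
  Induction on the number of generators: the coordinate \<open>f\<close> of the splitting generator is a homomorphism
  to a cyclic group, the complementary part \<open>f'\<close> one to a group with fewer generators, and by additivity
  the value of \<open>h\<close> on a cycle is the sum of its values on the two images.
\<close>

lemma double_vanishes_on_int_span:
  fixes b :: "'i \<Rightarrow> 'a"
  assumes "finite I" "b \<in> I \<rightarrow> carrier K" "X \<in> bar_cycles 3 (K\<lparr>carrier := int_span K I b\<rparr>)"
  shows "h_eval X + h_eval X \<in> N"
  using assms
proof (induction "card I" arbitrary: I b X)
  case 0
  then have "int_span K I b = range (\<lambda>k::int. \<one> [^] k)"
    by (auto simp: int_span_def int_comb_def)
  with 0 show ?case using double_vanishes_on_cyclic[of \<one> X] by simp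
next
  case (Suc n)
  then have "I \<noteq> {}" by auto
  obtain b' i where b': "b' \<in> I \<rightarrow> carrier K" and i: "i \<in> I"
    and span: "int_span K I b' = int_span K I b"
    and rel: "\<And>v. int_comb K I b' v = \<one> \<Longrightarrow> b' i [^] v i = \<one>"
    using exists_splitting_generator[OF Suc.prems(1) \<open>I \<noteq> {}\<close> Suc.prems(2)] by metis
  have b'i: "b' i \<in> carrier K" and b'': "b' \<in> I - {i} \<rightarrow> carrier K" using b' i by auto
  define C where "C = int_span K I b'"
  have C: "subgroup C K" unfolding C_def by (rule subgroup_int_span[OF b'])
  define coord where "coord = inv_into UNIV (int_comb K I b')"
  define f where "f = (\<lambda>y. b' i [^] coord y i)"
  define f' where "f' = (\<lambda>y. inv f y \<otimes> y)"
  have f_comb: "f (int_comb K I b' v) = b' i [^] v i" for v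
  proof -
    define w where "w = coord (int_comb K I b' v)"
    have "int_comb K I b' w = int_comb K I b' v"
      unfolding w_def coord_def by (simp add: f_inv_into_f)
    then have "b' i [^] (w i - v i) = \<one>"
      using rel[of "\<lambda>j. w j - v j"] b' by (simp add: int_comb_diff)
    then show ?thesis
      using b'i by (simp add: f_def int_pow_diff flip: w_def) (metis int_pow_closed inv_closed inv_equality inv_inv)
  qed
  have f'_comb: "f' (int_comb K I b' v) = int_comb K (I - {i}) b' v" for v
  proof -
    have "f' (int_comb K I b' v) = inv (b' i [^] v i) \<otimes> int_comb K I b' v"
      unfolding f'_def f_comb ..
    also have "\<dots> = inv (b' i [^] v i) \<otimes> (b' i [^] v i \<otimes> int_comb K (I - {i}) b' v)"
      using int_comb_remove[OF Suc.prems(1) i b', of v] by simp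
    also have "\<dots> = int_comb K (I - {i}) b' v"
      using b'i b'' by (simp flip: m_assoc)
    finally show ?thesis .
  qed
  have elems: "\<exists>v. y = int_comb K I b' v" if "y \<in> C" for y
    using that by (auto simp: C_def int_span_def)
  have split: "f y \<otimes> f' y = y" if "y \<in> C" for y
  proof -
    from elems[OF that] obtain v where v: "y = int_comb K I b' v" by blast
    show ?thesis
      unfolding v f_comb f'_comb using int_comb_remove[OF Suc.prems(1) i b', of v] by simp
  qed
  have f_hom: "f \<in> hom (K\<lparr>carrier := C\<rparr>) (K\<lparr>carrier := range (\<lambda>k::int. b' i [^] k)\<rparr>)"
  proof (rule homI)
    fix x y assume "x \<in> carrier (K\<lparr>carrier := C\<rparr>)" "y \<in> carrier (K\<lparr>carrier := C\<rparr>)"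
    then have "x \<in> C" "y \<in> C" by simp_all
    then obtain v w where "x = int_comb K I b' v" "y = int_comb K I b' w"
      using elems by meson
    then show "f (x \<otimes>\<^bsub>K\<lparr>carrier := C\<rparr>\<^esub> y) =
        f x \<otimes>\<^bsub>K\<lparr>carrier := range (\<lambda>k::int. b' i [^] k)\<rparr>\<^esub> f y"
      using b' b'i by (simp add: f_comb int_pow_mult flip: int_comb_add)
  qed (simp add: f_def)
  have f'_hom: "f' \<in> hom (K\<lparr>carrier := C\<rparr>) (K\<lparr>carrier := int_span K (I - {i}) b'\<rparr>)"
  proof (rule homI)
    fix x y assume "x \<in> carrier (K\<lparr>carrier := C\<rparr>)" "y \<in> carrier (K\<lparr>carrier := C\<rparr>)"
    then have "x \<in> C" "y \<in> C" by simp_all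
    then obtain v w where vw: "x = int_comb K I b' v" "y = int_comb K I b' w"
      using elems by meson
    then show "f' (x \<otimes>\<^bsub>K\<lparr>carrier := C\<rparr>\<^esub> y) = f' x \<otimes>\<^bsub>K\<lparr>carrier := int_span K (I - {i}) b'\<rparr>\<^esub> f' y"
      using f'_comb[of "\<lambda>j. v j + w j"] int_comb_add[OF b', of v w] int_comb_add[OF b'', of v w]
      by (simp add: f'_comb)
    show "f' x \<in> carrier (K\<lparr>carrier := int_span K (I - {i}) b'\<rparr>)"
      using vw by (auto simp: f'_comb int_span_def)
  qed
  have X: "X \<in> bar_cycles 3 (K\<lparr>carrier := C\<rparr>)"
    using Suc.prems(3) by (simp add: C_def span)
  let ?X = "bar_map f X" and ?X' = "bar_map f' X"
  have 1: "h_eval ?X + h_eval ?X \<in> N"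
    by (rule double_vanishes_on_cyclic[OF b'i bar_map_cycles[OF f_hom X]])
  have 2: "h_eval ?X' + h_eval ?X' \<in> N"
  proof (rule Suc.hyps(1)[OF _ _ b'' bar_map_cycles[OF f'_hom X]])
    show "n = card (I - {i})" using Suc.hyps(2) Suc.prems(1) i by simp
  qed (use Suc.prems(1) in simp)
  have "f \<in> hom (K\<lparr>carrier := C\<rparr>) K" "f' \<in> hom (K\<lparr>carrier := C\<rparr>) K"
    using f_hom f'_hom b'i subgroup.subset[OF subgroup_int_span[OF b'']]
    by (auto simp: hom_def f_def Pi_iff)
  then have "h_eval X - (h_eval ?X + h_eval ?X') \<in> N" (is "?d \<in> N")
    using subgroup.subset[OF C] X split subgroup.m_closed[OF C] by (intro h_eval_split)
  have "h_eval X + h_eval X = ?d + ?d + ((h_eval ?X + h_eval ?X) + (h_eval ?X' + h_eval ?X'))"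
    by (simp add: algebra_simps)
  also have "\<dots> \<in> N" by (intro N_add 1 2 \<open>?d \<in> N\<close>)
  finally show ?case .
qed

lemma double_vanishes_on_cycles:
  assumes X: "X \<in> bar_cycles 3 K"
  shows "h_eval X + h_eval X \<in> N"
proof -
  define I where "I = (\<Union>xs\<in>Poly_Mapping.keys X. set xs)"
  have keys: "Poly_Mapping.keys X \<subseteq> bar_tuples 3 K" and bd: "bar_boundary K X = 0"
    using X by (auto simp: bar_cycles_def bar_chain_group_def)
  have fin: "finite I" by (simp add: I_def)
  have I: "(\<lambda>x. x) \<in> I \<rightarrow> carrier K" using keys by (fastforce simp: I_def bar_tuples_def)
  have "x \<in> int_span K I (\<lambda>x. x)" if "x \<in> I" for x
  proof -
    have "int_comb K I (\<lambda>x. x) (\<lambda>j. if j = x then 1 else 0) = x \<otimes> int_comb K (I - {x}) (\<lambda>x. x) (\<lambda>j. if j = x then 1 else 0)"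
      using int_comb_remove[OF fin that I, of "\<lambda>j. if j = x then 1 else 0"] I that
      by (auto simp: Pi_iff)
    also have "int_comb K (I - {x}) (\<lambda>x. x) (\<lambda>j. if j = x then 1 else 0) = int_comb K (I - {x}) (\<lambda>x. x) (\<lambda>j. 0)"
      using I by (intro int_comb_cong) auto
    also have "\<dots> = \<one>" by (rule int_comb_zero)
    finally have "int_comb K I (\<lambda>x. x) (\<lambda>j. if j = x then 1 else 0) = x"
      using I that by (simp only: Pi_iff r_one)
    then show ?thesis unfolding int_span_def by (metis rangeI)
  qed
  with keys have "Poly_Mapping.keys X \<subseteq> bar_tuples 3 (K\<lparr>carrier := int_span K I (\<lambda>x. x)\<rparr>)"
    by (auto simp: bar_tuples_def I_def)
  with bd have "X \<in> bar_cycles 3 (K\<lparr>carrier := int_span K I (\<lambda>x. x)\<rparr>)"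
    by (simp add: bar_cycles_def bar_chain_group_def)
  then show ?thesis using fin I by (intro double_vanishes_on_int_span)
qed

end

section \<open>Shuffle products with central elements\<close>

text \<open>
  The shuffle product \<open>[a] * w\<close> of the bar complex.
\<close>

definition shuffle :: "'a \<Rightarrow> ('a list \<Rightarrow>\<^sub>0 int) \<Rightarrow> ('a list \<Rightarrow>\<^sub>0 int)" where
  "shuffle a = frag_extend
    (\<lambda>xs. \<Sum>i\<le>length xs. frag_cmul ((-1) ^ i) (frag_of (take i xs @ a # drop i xs)))"

lemma shuffle_simps:
  "shuffle a (frag_of [x]) = frag_of [a, x] - frag_of [x, a]"
  "shuffle a (frag_of [x, y]) = frag_of [a, x, y] - frag_of [x, a, y] + frag_of [x, y, a]"
  "shuffle a (frag_of [x, y, z]) =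
    frag_of [a, x, y, z] - frag_of [x, a, y, z] + frag_of [x, y, a, z] - frag_of [x, y, z, a]"
  "shuffle a 0 = 0"
  "shuffle a (u + v) = shuffle a u + shuffle a v"
  "shuffle a (u - v) = shuffle a u - shuffle a v"
  by (simp_all add: shuffle_def frag_extend_add frag_extend_diff eval_nat_numeral algebra_simps)

lemma shuffle_in_chains:
  assumes "a \<in> carrier G" "w \<in> carrier (bar_chain_group n G)"
  shows "shuffle a w \<in> carrier (bar_chain_group (Suc n) G)"
proof -
  have "Poly_Mapping.keys w \<subseteq> bar_tuples n G"
    using assms(2) by (simp add: bar_chain_group_def)
  then show ?thesis
  proof (induction w rule: frag_induction)
    case (one xs)
    have "frag_cmul ((-1) ^ i) (frag_of (take i xs @ a # drop i xs))
        \<in> carrier (free_Abelian_group (bar_tuples (Suc n) G))" for i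
      using one assms(1) keys_cmul
      by (fastforce simp: keys_frag_of bar_tuples_def dest: in_set_takeD in_set_dropD)
    then show ?case
      by (auto simp: shuffle_def bar_chain_group_def simp del: carrier_free_Abelian_group_iff
          intro!: sum_closed_free_Abelian_group)
  qed (simp_all add: shuffle_simps bar_chains_diff)
qed

text \<open>
  The shuffle product is the chain-level form of the homomorphism \<open>Z \<times> G \<rightarrow> G\<close>, \<open>(a, g) \<mapsto> a g\<close>. This is the
  Leibniz rule for it, in which \<open>\<partial>[a] = 0\<close>; centrality of \<open>a\<close> makes the faces that multiply \<open>a\<close> with its
  left and with its right neighbour cancel.
\<close>

lemma boundary_shuffle:
  assumes "group G" and a: "a \<in> group_center G"
    and w: "w \<in> carrier (bar_chain_group n G)" and n: "n \<in> {1, 2, 3}"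
  shows "bar_boundary G (shuffle a w) = - shuffle a (bar_boundary G w)"
proof -
  have comm: "x \<otimes>\<^bsub>G\<^esub> a = a \<otimes>\<^bsub>G\<^esub> x" if "x \<in> carrier G" for x
    using a that by (simp add: group_center_def)
  have "Poly_Mapping.keys w \<subseteq> bar_tuples n G"
    using w by (simp add: bar_chain_group_def)
  then show ?thesis
  proof (induction w rule: frag_induction)
    case (one xs)
    then have car: "set xs \<subseteq> carrier G" and len: "length xs = n" by (simp_all add: bar_tuples_def)
    from n len consider x where "xs = [x]" | x y where "xs = [x, y]" | x y z where "xs = [x, y, z]"
      by (auto simp: length_Suc_conv eval_nat_numeral)
    then show ?case
      by cases (use car in \<open>simp_all add: shuffle_simps bar_boundary_simps bar_boundary_add
        bar_boundary_diff comm\<close>)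
  qed (simp_all add: shuffle_simps bar_boundary_diff)
qed

text \<open>
  The shuffle product \<open>[a|b] * w\<close>: the entries \<open>a\<close> and \<open>b\<close> are inserted in this order, after the first \<open>i\<close>
  and the first \<open>j\<close> entries.
\<close>

definition pair_shuffle :: "'a \<Rightarrow> 'a \<Rightarrow> ('a list \<Rightarrow>\<^sub>0 int) \<Rightarrow> ('a list \<Rightarrow>\<^sub>0 int)" where
  "pair_shuffle a b = frag_extend (\<lambda>xs. \<Sum>j\<le>length xs. \<Sum>i\<le>j.
    frag_cmul ((-1) ^ (i + j)) (frag_of (take i xs @ a # take (j - i) (drop i xs) @ b # drop j xs)))"

lemma pair_shuffle_simps:
  "pair_shuffle a b (frag_of [x]) = shuffle x (frag_of [a, b])"
  "pair_shuffle a b (frag_of [x, y]) = frag_of [a, b, x, y] - frag_of [a, x, b, y] + frag_of [x, a, b, y]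
    + frag_of [a, x, y, b] - frag_of [x, a, y, b] + frag_of [x, y, a, b]"
  "pair_shuffle a b 0 = 0"
  "pair_shuffle a b (u + v) = pair_shuffle a b u + pair_shuffle a b v"
  "pair_shuffle a b (u - v) = pair_shuffle a b u - pair_shuffle a b v"
  by (simp_all add: pair_shuffle_def shuffle_simps frag_extend_add frag_extend_diff eval_nat_numeral
      algebra_simps)

lemma pair_shuffle_in_chains:
  assumes "a \<in> carrier G" "b \<in> carrier G" "w \<in> carrier (bar_chain_group n G)"
  shows "pair_shuffle a b w \<in> carrier (bar_chain_group (Suc (Suc n)) G)"
proof -
  have "Poly_Mapping.keys w \<subseteq> bar_tuples n G"
    using assms(3) by (simp add: bar_chain_group_def)
  then show ?thesis
  proof (induction w rule: frag_induction)
    case (one xs)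
    have "frag_cmul ((-1) ^ (i + j))
          (frag_of (take i xs @ a # take (j - i) (drop i xs) @ b # drop j xs))
        \<in> carrier (free_Abelian_group (bar_tuples (Suc (Suc n)) G))" if "i \<le> j" "j \<le> length xs" for i j
    proof -
      have "take i xs @ a # take (j - i) (drop i xs) @ b # drop j xs \<in> bar_tuples (Suc (Suc n)) G"
        using one assms(1,2) that by (auto simp: bar_tuples_def dest!: in_set_takeD in_set_dropD)
      then show ?thesis by (auto simp: keys_frag_of)
    qed
    then show ?case
      by (auto simp: pair_shuffle_def bar_chain_group_def simp del: carrier_free_Abelian_group_iff
          intro!: sum_closed_free_Abelian_group)
  qed (simp_all add: pair_shuffle_simps bar_chains_diff)
qed

text \<open>
  The Leibniz rule again: the first three terms are \<open>\<partial>[a|b] * w\<close>.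
\<close>

lemma boundary_pair_shuffle:
  assumes "group G" and a: "a \<in> group_center G" and b: "b \<in> group_center G"
    and w: "w \<in> carrier (bar_chain_group 2 G)"
  shows "bar_boundary G (pair_shuffle a b w) =
    shuffle a w - shuffle (a \<otimes>\<^bsub>G\<^esub> b) w + shuffle b w + pair_shuffle a b (bar_boundary G w)"
proof -
  have comm: "x \<otimes>\<^bsub>G\<^esub> a = a \<otimes>\<^bsub>G\<^esub> x" "x \<otimes>\<^bsub>G\<^esub> b = b \<otimes>\<^bsub>G\<^esub> x" if "x \<in> carrier G" for x
    using a b that by (simp_all add: group_center_def)
  have "Poly_Mapping.keys w \<subseteq> bar_tuples 2 G"
    using w by (simp add: bar_chain_group_def)
  then show ?thesis
  proof (induction w rule: frag_induction)
    case (one xs)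
    then obtain x y where xs: "xs = [x, y]" and x: "x \<in> carrier G" and y: "y \<in> carrier G"
      by (auto simp: bar_tuples_def length_Suc_conv eval_nat_numeral)
    show ?case
      using comm(2)[OF y] comm[OF x]
      by (simp add: xs comm[OF x] comm[OF y] shuffle_simps pair_shuffle_simps bar_boundary_simps bar_boundary_add
        bar_boundary_diff)
  qed (simp_all add: pair_shuffle_simps shuffle_simps bar_boundary_diff)
qed

section \<open>Central 3-cycles in groups without first and second homology\<close>

lemma subgroup_group_center:
  assumes "group G"
  shows "subgroup (group_center G) G"
proof -
  interpret group G by fact
  show ?thesis
  proof
    show "group_center G \<subseteq> carrier G" "\<one>\<^bsub>G\<^esub> \<in> group_center G" by (auto simp: group_center_def)
    fix x y assume x: "x \<in> group_center G" and y: "y \<in> group_center G"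
    have xy: "x \<in> carrier G" "y \<in> carrier G"
      using x y by (simp_all add: group_center_def)
    have comm: "x \<otimes>\<^bsub>G\<^esub> g = g \<otimes>\<^bsub>G\<^esub> x" "y \<otimes>\<^bsub>G\<^esub> g = g \<otimes>\<^bsub>G\<^esub> y" if "g \<in> carrier G" for g
      using x y that by (simp_all add: group_center_def)
    have "x \<otimes>\<^bsub>G\<^esub> y \<otimes>\<^bsub>G\<^esub> g = g \<otimes>\<^bsub>G\<^esub> (x \<otimes>\<^bsub>G\<^esub> y)" if g: "g \<in> carrier G" for g
    proof -
      have "x \<otimes>\<^bsub>G\<^esub> y \<otimes>\<^bsub>G\<^esub> g = x \<otimes>\<^bsub>G\<^esub> (g \<otimes>\<^bsub>G\<^esub> y)" using xy g comm(2) by (simp add: m_assoc)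
      also have "\<dots> = g \<otimes>\<^bsub>G\<^esub> x \<otimes>\<^bsub>G\<^esub> y" using xy g comm(1) by (simp flip: m_assoc)
      finally show ?thesis using xy g by (simp add: m_assoc)
    qed
    then show "x \<otimes>\<^bsub>G\<^esub> y \<in> group_center G"
      using m_closed[OF xy] unfolding group_center_def by blast
    have "inv\<^bsub>G\<^esub> x \<otimes>\<^bsub>G\<^esub> g = g \<otimes>\<^bsub>G\<^esub> inv\<^bsub>G\<^esub> x" if g: "g \<in> carrier G" for g
    proof -
      have "inv\<^bsub>G\<^esub> x \<otimes>\<^bsub>G\<^esub> g = inv\<^bsub>G\<^esub> x \<otimes>\<^bsub>G\<^esub> (g \<otimes>\<^bsub>G\<^esub> x) \<otimes>\<^bsub>G\<^esub> inv\<^bsub>G\<^esub> x"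
        using xy g by (simp add: m_assoc)
      also have "\<dots> = g \<otimes>\<^bsub>G\<^esub> inv\<^bsub>G\<^esub> x"
        unfolding comm(1)[OF g, symmetric] using xy g by (simp flip: m_assoc)
      finally show ?thesis .
    qed
    then show "inv\<^bsub>G\<^esub> x \<in> group_center G"
      using inv_closed[OF xy(1)] unfolding group_center_def by blast
  qed
qed

abbreviation center_group :: "('a, 'm) monoid_scheme \<Rightarrow> ('a, 'm) monoid_scheme" where
  "center_group G \<equiv> G\<lparr>carrier := group_center G\<rparr>"

lemma comm_group_center:
  assumes "group G"
  shows "comm_group (center_group G)"
proof (rule group.group_comm_groupI)
  show "group (center_group G)"
    using group.subgroup_imp_group[OF assms subgroup_group_center[OF assms]] .
  fix x y assume "x \<in> carrier (center_group G)" "y \<in> carrier (center_group G)"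
  then have "x \<in> carrier G" "y \<in> group_center G" by (simp_all add: group_center_def)
  then have "y \<otimes>\<^bsub>G\<^esub> x = x \<otimes>\<^bsub>G\<^esub> y" unfolding group_center_def by blast
  then show "x \<otimes>\<^bsub>center_group G\<^esub> y = y \<otimes>\<^bsub>center_group G\<^esub> x" by simp
qed

locale superperfect_group = group G for G :: "('a, 'm) monoid_scheme" (structure) +
  assumes H1_trivial: "g \<in> carrier G \<Longrightarrow> frag_of [g] \<in> bar_boundaries 1 G"
    and H2_trivial: "bar_cycles 2 G \<subseteq> bar_boundaries 2 G"
begin

text \<open>
  The pair \<open>(h, c)\<close> described at the beginning. Its relations hold for the following reasons. The
  coboundary of \<open>h\<close> is the boundary of a 4-tuple, as \<open>\<delta>\<delta>v = 0\<close>. The two sides of the hexagon relation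
  for \<open>a, b, c\<close> differ by \<open>[a] * \<partial>v(b, c)\<close>, which is a boundary because \<open>a\<close> is central. Symmetrising removes \<open>v\<close> from
  \<open>c\<close> and leaves \<open>[a] * u(b) + [b] * u(a)\<close>; this is additive in \<open>a\<close> up to the boundary of \<open>[a|a'] * u(b)\<close>
  and a boundary \<open>[b] * \<partial>v(a, a')\<close>, because the shuffle products of \<open>[a|a']\<close> and \<open>[b]\<close> in both orders agree.
\<close>

lemma double_central_3_cycle:
  assumes X: "X \<in> bar_cycles 3 (center_group G)"
  shows "X + X \<in> bar_boundaries 3 G"
proof -
  let ?C = "\<lambda>n. carrier (bar_chain_group n G)" and ?Z = "group_center G" and ?N = "bar_boundaries 3 G"
  let ?d = "bar_boundary G"
  interpret Z: comm_group "center_group G" by (rule comm_group_center[OF is_group])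
  have Z_closed: "a \<otimes> b \<in> ?Z" if "a \<in> ?Z" "b \<in> ?Z" for a b
    using Z.m_closed that by simp
  have Z_comm: "a \<otimes> b = b \<otimes> a" if "a \<in> ?Z" "b \<in> ?Z" for a b
    using Z.m_comm that by simp
  have ZG: "a \<in> carrier G" if "a \<in> ?Z" for a using that by (simp add: group_center_def)
  interpret N: chain_relations ?N by (rule bar_boundaries_chain_relations[OF is_group])
  have boundary_N: "?d w \<in> ?N" if "w \<in> ?C 4" for w
    using that by (simp add: bar_boundaries_def)
  define u where "u = (\<lambda>a. SOME w. w \<in> ?C 2 \<and> ?d w = frag_of [a])"
  have u: "u a \<in> ?C 2" "?d (u a) = frag_of [a]" if "a \<in> carrier G" for a
  proof -
    have "\<exists>w. w \<in> ?C 2 \<and> ?d w = frag_of [a]"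
      using H1_trivial[OF that] by (auto simp: bar_boundaries_def eval_nat_numeral)
    from someI_ex[OF this] show "u a \<in> ?C 2" "?d (u a) = frag_of [a]" by (simp_all add: u_def)
  qed
  define v where "v = (\<lambda>a b. SOME w. w \<in> ?C 3 \<and> ?d w = frag_of [a, b] - u a - u b + u (a \<otimes> b))"
  have v: "v a b \<in> ?C 3" "?d (v a b) = frag_of [a, b] - u a - u b + u (a \<otimes> b)"
    if "a \<in> carrier G" "b \<in> carrier G" for a b
  proof -
    have "frag_of [a, b] \<in> ?C 2" using generator_in_chains[of "[a, b]" G 2] that by simp
    then have "frag_of [a, b] - u a - u b - (0 - u (a \<otimes> b)) \<in> bar_cycles 2 G"
      using that by (simp add: bar_cycles_def bar_chains_diff u bar_boundary_diff bar_boundary_simps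
          del: diff_0)
    then have "frag_of [a, b] - u a - u b + u (a \<otimes> b) \<in> bar_boundaries 2 G"
      using H2_trivial by auto
    then have "\<exists>w. w \<in> ?C 3 \<and> ?d w = frag_of [a, b] - u a - u b + u (a \<otimes> b)"
      unfolding bar_boundaries_def by (force simp: eval_nat_numeral)
    from someI_ex[OF this] show "v a b \<in> ?C 3"
      "?d (v a b) = frag_of [a, b] - u a - u b + u (a \<otimes> b)" by (simp_all add: v_def)
  qed
  have shuffle_boundary: "shuffle a (?d w) \<in> ?N" if "a \<in> ?Z" "w \<in> ?C 3" for a w
  proof -
    have "?d (shuffle a w) \<in> ?N"
      using boundary_N shuffle_in_chains[OF ZG[OF that(1)] that(2)] by (simp add: eval_nat_numeral)
    then have "- ?d (shuffle a w) \<in> ?N" by (rule N.N_minus)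
    then show ?thesis using boundary_shuffle[OF is_group that] by simp
  qed
  define h where "h = (\<lambda>a b c. frag_of [a, b, c] - (v b c - v (a \<otimes> b) c + v a (b \<otimes> c) - v a b))"
  define c where "c = (\<lambda>a b. v a b - v b a + shuffle a (u b))"
  interpret abelian_cocycle "center_group G" ?N h c
  proof
    fix x y z w
    assume "x \<in> carrier (center_group G)" "y \<in> carrier (center_group G)"
      "z \<in> carrier (center_group G)"
    then have Z: "x \<in> ?Z" "y \<in> ?Z" "z \<in> ?Z" by simp_all
    note G = Z[THEN ZG]
    {
      assume "w \<in> carrier (center_group G)"
      then have w: "w \<in> carrier G" using ZG by simp
      have "h y z w - h (x \<otimes> y) z w + h x (y \<otimes> z) w - h x y (z \<otimes> w) + h x y z =
          ?d (frag_of [x, y, z, w])"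
        using G w by (simp add: h_def bar_boundary_simps m_assoc algebra_simps)
      also have "\<dots> \<in> ?N" using boundary_N generator_in_chains[of "[x, y, z, w]" G 4] G w by simp
      finally show "h y z w - h (x \<otimes>\<^bsub>center_group G\<^esub> y) z w + h x (y \<otimes>\<^bsub>center_group G\<^esub> z) w
          - h x y (z \<otimes>\<^bsub>center_group G\<^esub> w) + h x y z \<in> ?N" by simp
    next
      have "h x y z - h y x z + h y z x - (c x y + c x z - c x (y \<otimes> z)) = shuffle x (?d (v y z))"
        using Z_comm[OF Z(1,2)] Z_comm[OF Z(1,3)] Z_comm[OF Z(1) Z_closed[OF Z(2,3)]] G
        by (simp add: h_def c_def v shuffle_simps algebra_simps)
      also have "\<dots> \<in> ?N" using shuffle_boundary Z(1) v(1) G by simp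
      finally show "h x y z - h y x z + h y z x - (c x y + c x z - c x (y \<otimes>\<^bsub>center_group G\<^esub> z)) \<in> ?N"
        by simp
    next
      have "c (x \<otimes> y) z + c z (x \<otimes> y) - (c x z + c z x) - (c y z + c z y) =
          - ?d (pair_shuffle x y (u z)) + shuffle z (?d (v x y))"
        using G boundary_pair_shuffle[OF is_group Z(1,2) u(1)[OF G(3)]]
        by (simp add: c_def u v shuffle_simps pair_shuffle_simps algebra_simps)
      also have "\<dots> \<in> ?N"
        using shuffle_boundary[OF Z(3) v(1)] pair_shuffle_in_chains[OF _ _ u(1)] G
        by (intro N.N_add N.N_minus boundary_N) (simp_all add: eval_nat_numeral)
      finally show "c (x \<otimes>\<^bsub>center_group G\<^esub> y) z + c z (x \<otimes>\<^bsub>center_group G\<^esub> y)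
          - (c x z + c z x) - (c y z + c z y) \<in> ?N" by simp
    }
  qed
  \<comment> \<open>\<open>[a|b|c] - h(a, b, c)\<close> is the coboundary of \<open>v\<close>, so that \<open>X\<close> is homologous to its value under \<open>h\<close>.\<close>
  have "frag_extend (\<lambda>xs. frag_of [xs ! 0, xs ! 1, xs ! 2] - h (xs ! 0) (xs ! 1) (xs ! 2)) X \<in> ?N"
    by (rule N.coboundary_vanishes_on_cycles[OF X, where \<phi> = "\<lambda>x y z. frag_of [x, y, z] - h x y z"
          and g = v]) (simp add: h_def)
  moreover have "frag_extend (\<lambda>xs. frag_of [xs ! 0, xs ! 1, xs ! 2] - h (xs ! 0) (xs ! 1) (xs ! 2)) X =
      X - h_eval X"
  proof -
    have "Poly_Mapping.keys X \<subseteq> bar_tuples 3 (center_group G)"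
      using X by (auto simp: bar_cycles_def bar_chain_group_def)
    then show ?thesis
    proof (induction X rule: frag_induction)
      case (one xs)
      then obtain x y z where "xs = [x, y, z]"
        by (auto simp: bar_tuples_def length_Suc_conv eval_nat_numeral)
      then show ?case by simp
    qed (simp_all add: frag_extend_diff)
  qed
  ultimately have 1: "X - h_eval X \<in> ?N" by simp
  have 2: "h_eval X + h_eval X \<in> ?N" using X by (rule double_vanishes_on_cycles)
  have "X + X = (X - h_eval X) + (X - h_eval X) + (h_eval X + h_eval X)" by simp
  also have "\<dots> \<in> ?N" by (intro N.N_add 1 2)
  finally show ?thesis .
qed

end

section \<open>The first two homology groups of a universal central extension\<close>

lemma universal_lift_unique:
  assumes univ: "universal_central_extension A G Q i p" and ext: "central_extension B E Q j q"
    and f: "f \<in> hom G E" "\<And>x. x \<in> carrier G \<Longrightarrow> q (f x) = p x"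
    and g: "g \<in> hom G E" "\<And>x. x \<in> carrier G \<Longrightarrow> q (g x) = p x"
    and x: "x \<in> carrier G"
  shows "f x = g x"
proof -
  have "group G" using univ by (simp add: universal_central_extension_def central_extension_def)
  then interpret group G .
  have lift: "restrict u (carrier G) \<in> hom G E \<and> restrict u (carrier G) \<in> extensional (carrier G)
      \<and> (\<forall>x\<in>carrier G. q (restrict u (carrier G) x) = p x)"
    if "u \<in> hom G E" "\<And>x. x \<in> carrier G \<Longrightarrow> q (u x) = p x" for u
    using that by (auto simp: hom_def)
  have "restrict f (carrier G) = restrict g (carrier G)"
    using universal_central_extension_universal[OF univ ext] lift[OF f] lift[OF g] by blast
  then show ?thesis using x by (metis restrict_apply')
qed

lemma central_extension_kernel:
  assumes "group E" "group Q" "q \<in> epi E Q" "kernel E Q q \<subseteq> group_center E"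
  shows "central_extension (E\<lparr>carrier := kernel E Q q\<rparr>) E Q id q"
proof -
  interpret group_hom E Q q
    using assms by (simp add: group_hom_def group_hom_axioms_def epi_def)
  have "id \<in> mon (E\<lparr>carrier := kernel E Q q\<rparr>) E" by (auto simp: mon_def hom_def kernel_def)
  then show ?thesis
    using assms G.subgroup_imp_group[OF subgroup_kernel] by (simp add: central_extension_def)
qed

text \<open>
  The extension of \<open>G\<close> by the abelian group \<open>M\<close>, on which \<open>G\<close> acts trivially, with factor set \<open>\<phi>\<close>.
\<close>

definition cocycle_extension ::
    "('g, 'l) monoid_scheme \<Rightarrow> ('m, 'k) monoid_scheme \<Rightarrow> ('g \<Rightarrow> 'g \<Rightarrow> 'm) \<Rightarrow> ('g \<times> 'm) monoid" where
  "cocycle_extension G M \<phi> =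
    \<lparr>carrier = carrier G \<times> carrier M,
     mult = \<lambda>(g, m) (h, n). (g \<otimes>\<^bsub>G\<^esub> h, m \<otimes>\<^bsub>M\<^esub> n \<otimes>\<^bsub>M\<^esub> \<phi> g h),
     one = (\<one>\<^bsub>G\<^esub>, \<one>\<^bsub>M\<^esub>)\<rparr>"

lemma group_cocycle_extension:
  assumes "group G" "comm_group M"
    and closed: "\<And>g h. \<lbrakk>g \<in> carrier G; h \<in> carrier G\<rbrakk> \<Longrightarrow> \<phi> g h \<in> carrier M"
    and cocycle: "\<And>g h k. \<lbrakk>g \<in> carrier G; h \<in> carrier G; k \<in> carrier G\<rbrakk> \<Longrightarrow>
      \<phi> g h \<otimes>\<^bsub>M\<^esub> \<phi> (g \<otimes>\<^bsub>G\<^esub> h) k = \<phi> h k \<otimes>\<^bsub>M\<^esub> \<phi> g (h \<otimes>\<^bsub>G\<^esub> k)"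
    and normalised: "\<And>g. g \<in> carrier G \<Longrightarrow> \<phi> \<one>\<^bsub>G\<^esub> g = \<one>\<^bsub>M\<^esub>"
  shows "group (cocycle_extension G M \<phi>)"
proof (rule groupI)
  interpret G: group G by fact
  interpret M: comm_group M by fact
  let ?E = "cocycle_extension G M \<phi>"
  note [simp] = cocycle_extension_def closed normalised
  show "\<one>\<^bsub>?E\<^esub> \<in> carrier ?E" by simp
  fix x assume "x \<in> carrier ?E"
  then obtain g m where x: "x = (g, m)" "g \<in> carrier G" "m \<in> carrier M" by auto
  show "\<one>\<^bsub>?E\<^esub> \<otimes>\<^bsub>?E\<^esub> x = x" using x by simp
  show "\<exists>y\<in>carrier ?E. y \<otimes>\<^bsub>?E\<^esub> x = \<one>\<^bsub>?E\<^esub>"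
    by (rule bexI[of _ "(inv\<^bsub>G\<^esub> g, inv\<^bsub>M\<^esub> (m \<otimes>\<^bsub>M\<^esub> \<phi> (inv\<^bsub>G\<^esub> g) g))"])
      (use x in \<open>simp_all add: M.m_assoc\<close>)
  fix y assume "y \<in> carrier ?E"
  then obtain h n where y: "y = (h, n)" "h \<in> carrier G" "n \<in> carrier M" by auto
  show "x \<otimes>\<^bsub>?E\<^esub> y \<in> carrier ?E" using x y by simp
  fix z assume "z \<in> carrier ?E"
  then obtain k l where z: "z = (k, l)" "k \<in> carrier G" "l \<in> carrier M" by auto
  have "m \<otimes>\<^bsub>M\<^esub> n \<otimes>\<^bsub>M\<^esub> \<phi> g h \<otimes>\<^bsub>M\<^esub> l \<otimes>\<^bsub>M\<^esub> \<phi> (g \<otimes>\<^bsub>G\<^esub> h) k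
      = m \<otimes>\<^bsub>M\<^esub> n \<otimes>\<^bsub>M\<^esub> l \<otimes>\<^bsub>M\<^esub> (\<phi> g h \<otimes>\<^bsub>M\<^esub> \<phi> (g \<otimes>\<^bsub>G\<^esub> h) k)"
    using x y z by (simp add: M.m_ac)
  also have "\<dots> = m \<otimes>\<^bsub>M\<^esub> (n \<otimes>\<^bsub>M\<^esub> l \<otimes>\<^bsub>M\<^esub> \<phi> h k) \<otimes>\<^bsub>M\<^esub> \<phi> g (h \<otimes>\<^bsub>G\<^esub> k)"
    unfolding cocycle[OF x(2) y(2) z(2)] using x y z by (simp add: M.m_ac)
  finally show "x \<otimes>\<^bsub>?E\<^esub> y \<otimes>\<^bsub>?E\<^esub> z = x \<otimes>\<^bsub>?E\<^esub> (y \<otimes>\<^bsub>?E\<^esub> z)"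
    using x y z by (simp add: G.m_assoc)
qed

text \<open>
  The cokernel of \<open>\<partial> : C\<^sub>n\<^sub>+\<^sub>1(G) \<rightarrow> C\<^sub>n(G)\<close>. It contains \<open>H\<^sub>n(G)\<close>, and a generator \<open>[g\<^sub>1|\<dots>|g\<^sub>n]\<close>, unlike a homology
  class, is an element of it: \<open>(g\<^sub>1, \<dots>, g\<^sub>n) \<mapsto> [g\<^sub>1|\<dots>|g\<^sub>n]\<close> is the universal \<open>n\<close>-cocycle with trivial coefficients.
\<close>

definition bar_cokernel :: "nat \<Rightarrow> ('a, 'm) monoid_scheme \<Rightarrow> ('a list \<Rightarrow>\<^sub>0 int) set monoid" where
  "bar_cokernel n G = bar_chain_group n G Mod bar_boundaries n G"

definition bar_class :: "nat \<Rightarrow> ('a, 'm) monoid_scheme \<Rightarrow> ('a list \<Rightarrow>\<^sub>0 int) \<Rightarrow> ('a list \<Rightarrow>\<^sub>0 int) set" where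
  "bar_class n G c = bar_boundaries n G #>\<^bsub>bar_chain_group n G\<^esub> c"

lemma bar_cokernel_facts:
  assumes "group G"
  shows comm_group_bar_cokernel: "comm_group (bar_cokernel n G)"
    and bar_class_closed: "c \<in> carrier (bar_chain_group n G) \<Longrightarrow> bar_class n G c \<in> carrier (bar_cokernel n G)"
    and bar_class_add: "\<lbrakk>c \<in> carrier (bar_chain_group n G); d \<in> carrier (bar_chain_group n G)\<rbrakk> \<Longrightarrow>
      bar_class n G (c + d) = bar_class n G c \<otimes>\<^bsub>bar_cokernel n G\<^esub> bar_class n G d"
    and bar_class_eq_one: "c \<in> carrier (bar_chain_group n G) \<Longrightarrow>
      bar_class n G c = \<one>\<^bsub>bar_cokernel n G\<^esub> \<longleftrightarrow> c \<in> bar_boundaries n G"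
    and bar_class_surj: "m \<in> carrier (bar_cokernel n G) \<Longrightarrow>
      \<exists>c \<in> carrier (bar_chain_group n G). m = bar_class n G c"
proof -
  interpret C: comm_group "bar_chain_group n G" by simp
  have sub: "subgroup (bar_boundaries n G) (bar_chain_group n G)"
    by (rule subgroup_bar_boundaries[OF assms])
  then interpret N: normal "bar_boundaries n G" "bar_chain_group n G"
    by (simp add: C.normal_iff_subgroup)
  show "comm_group (bar_cokernel n G)"
    unfolding bar_cokernel_def by (rule C.abelian_FactGroup[OF sub])
  show "c \<in> carrier (bar_chain_group n G) \<Longrightarrow> bar_class n G c \<in> carrier (bar_cokernel n G)"
    by (auto simp: bar_cokernel_def bar_class_def FactGroup_def RCOSETS_def)
  show "\<lbrakk>c \<in> carrier (bar_chain_group n G); d \<in> carrier (bar_chain_group n G)\<rbrakk> \<Longrightarrow>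
      bar_class n G (c + d) = bar_class n G c \<otimes>\<^bsub>bar_cokernel n G\<^esub> bar_class n G d"
    using N.rcos_sum[of c d] by (simp add: bar_cokernel_def bar_class_def)
  show "c \<in> carrier (bar_chain_group n G) \<Longrightarrow>
      bar_class n G c = \<one>\<^bsub>bar_cokernel n G\<^esub> \<longleftrightarrow> c \<in> bar_boundaries n G"
    using C.coset_join1[OF _ _ sub] C.coset_join2[OF _ sub]
    by (auto simp: bar_cokernel_def bar_class_def FactGroup_def)
  show "m \<in> carrier (bar_cokernel n G) \<Longrightarrow> \<exists>c \<in> carrier (bar_chain_group n G). m = bar_class n G c"
    by (auto simp: bar_cokernel_def bar_class_def FactGroup_def RCOSETS_def)
qed

lemma bar_class_eq_iff:
  assumes "group G" "c \<in> carrier (bar_chain_group n G)" "d \<in> carrier (bar_chain_group n G)"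
  shows "bar_class n G c = bar_class n G d \<longleftrightarrow> c - d \<in> bar_boundaries n G"
proof -
  interpret M: comm_group "bar_cokernel n G" by (rule comm_group_bar_cokernel[OF assms(1)])
  have cd: "c - d \<in> carrier (bar_chain_group n G)" using assms by (simp add: bar_chains_diff)
  have "bar_class n G c = bar_class n G (c - d) \<otimes>\<^bsub>bar_cokernel n G\<^esub> bar_class n G d"
    using bar_class_add[OF assms(1) cd assms(3)] by simp
  then show ?thesis
    using bar_class_eq_one[OF assms(1) cd] bar_class_closed[OF assms(1) cd] bar_class_closed[OF assms(1,3)]
    by (metis M.l_one M.r_cancel_one')
qed

text \<open>
  The projection of \<open>Q \<times> C\<^sub>1/B\<^sub>1\<close> to \<open>Q\<close> is a central extension, and \<open>g \<mapsto> (p g, [g])\<close> and \<open>g \<mapsto> (p g, 0)\<close> are two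
  lifts of \<open>p\<close> to it.
\<close>

lemma universal_H1_trivial:
  assumes univ: "universal_central_extension A G Q i p" and g: "g \<in> carrier G"
  shows "frag_of [g] \<in> bar_boundaries 1 G"
proof -
  have ext: "central_extension A G Q i p"
    using univ by (simp add: universal_central_extension_def)
  then have grps: "group G" "group Q" and p: "p \<in> hom G Q"
    by (auto simp: central_extension_def epi_def)
  interpret G: group G by fact
  interpret Q: group Q by fact
  let ?M = "bar_cokernel 1 G" and ?E = "Q \<times>\<times> bar_cokernel 1 G"
  interpret M: comm_group ?M by (rule comm_group_bar_cokernel[OF grps(1)])
  have C1: "frag_of [x] \<in> carrier (bar_chain_group 1 G)" if "x \<in> carrier G" for x
    using that by (simp add: generator_in_chains)
  have "group ?E" by (rule DirProd_group[OF grps(2) M.is_group])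
  moreover have "fst \<in> epi ?E Q" 
    using M.one_closed by (auto simp: epi_def hom_def)
  moreover have "kernel ?E Q fst \<subseteq> group_center ?E"
    by (auto simp: kernel_def group_center_def M.m_comm simp del: One_nat_def)
  ultimately have extE: "central_extension (?E\<lparr>carrier := kernel ?E Q fst\<rparr>) ?E Q id fst"
    using grps(2) by (intro central_extension_kernel)
  have cls: "bar_class 1 G (frag_of [x \<otimes>\<^bsub>G\<^esub> y]) =
      bar_class 1 G (frag_of [x]) \<otimes>\<^bsub>?M\<^esub> bar_class 1 G (frag_of [y])"
    if "x \<in> carrier G" "y \<in> carrier G" for x y
  proof -
    interpret chain_relations "bar_boundaries 1 G" by (rule bar_boundaries_chain_relations[OF grps(1)])
    have "bar_boundary G (frag_of [x, y]) \<in> bar_boundaries 1 G"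
      using that by (intro boundary_in_boundaries generator_in_chains) auto
    then have "- bar_boundary G (frag_of [x, y]) \<in> bar_boundaries 1 G" by (rule N_minus)
    also have "- bar_boundary G (frag_of [x, y]) = frag_of [x \<otimes>\<^bsub>G\<^esub> y] - (frag_of [x] + frag_of [y])"
      by (simp add: bar_boundary_simps)
    finally have "bar_class 1 G (frag_of [x \<otimes>\<^bsub>G\<^esub> y]) = bar_class 1 G (frag_of [x] + frag_of [y])"
      using that C1 bar_chains_diff[OF C1 bar_chains_diff[OF bar_chains_0 C1]]
      by (subst bar_class_eq_iff[OF grps(1)]) simp_all
    then show ?thesis using that C1 by (simp add: bar_class_add[OF grps(1)])
  qed
  have p_closed: "p x \<in> carrier Q" if "x \<in> carrier G" for x using p that by (auto simp: hom_def)
  have "(p g, bar_class 1 G (frag_of [g])) = (p g, \<one>\<^bsub>?M\<^esub>)"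
  proof (rule universal_lift_unique[OF univ extE _ _ _ _ g])
    show "(\<lambda>x. (p x, bar_class 1 G (frag_of [x]))) \<in> hom G ?E"
      by (rule homI) (use p_closed C1 in \<open>simp_all add: bar_class_closed[OF grps(1)] cls hom_mult[OF p] del: One_nat_def\<close>)
    show "(\<lambda>x. (p x, \<one>\<^bsub>?M\<^esub>)) \<in> hom G ?E"
      by (rule homI) (use p_closed in \<open>simp_all add: hom_mult[OF p] del: One_nat_def\<close>)
  qed simp_all
  then show ?thesis using bar_class_eq_one[OF grps(1) C1[OF g]] by simp
qed

text \<open>
  The universal 2-cocycle \<open>[g|h]\<close>, normalised by subtracting \<open>[1|1]\<close>, defines an extension \<open>E\<close> of \<open>G\<close> by
  \<open>C\<^sub>2/B\<^sub>2\<close>. It is a central extension even of \<open>Q\<close>: for \<open>a\<close> central in \<open>G\<close> the commutator of lifts of \<open>a\<close> and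
  \<open>g\<close> is \<open>[a|g] - [g|a] = [a] * [g]\<close>, which is a boundary as \<open>[g]\<close> is one. By universality \<open>G\<close> maps to \<open>E\<close> over
  \<open>Q\<close>, and by uniqueness of lifts this is a section of \<open>E \<rightarrow> G\<close>. A section writes the cocycle as a
  coboundary, which vanishes on 2-cycles; but the universal cocycle sends a 2-cycle to its own class.
\<close>

lemma universal_H2_trivial:
  fixes G :: "('g, 'l) monoid_scheme"
  assumes univ: "universal_central_extension A G Q i p"
  shows "bar_cycles 2 G \<subseteq> bar_boundaries 2 G"
proof
  have ext: "central_extension A G Q i p"
    using univ by (simp add: universal_central_extension_def)
  then have grps: "group G" "group Q" and p: "p \<in> hom G Q" "p ` carrier G = carrier Q"
    and ker: "kernel G Q p \<subseteq> group_center G"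
    by (auto simp: central_extension_def epi_def)
  interpret G: group G by fact
  let ?M = "bar_cokernel 2 G" and ?C = "carrier (bar_chain_group 2 G)" and ?N = "bar_boundaries 2 G"
  interpret M: comm_group ?M by (rule comm_group_bar_cokernel[OF grps(1)])
  interpret chain_relations ?N by (rule bar_boundaries_chain_relations[OF grps(1)])
  have add_closed: "c + d \<in> ?C" if "c \<in> ?C" "d \<in> ?C" for c d
    using bar_chains_diff[OF that(1) bar_chains_diff[OF bar_chains_0 that(2)]] by simp
  have C2: "frag_of [x, y] \<in> ?C" if "x \<in> carrier G" "y \<in> carrier G" for x y
    using that by (simp add: generator_in_chains)
  have N3: "bar_boundary G (frag_of [x, y, z]) \<in> ?N"
    if "x \<in> carrier G" "y \<in> carrier G" "z \<in> carrier G" for x y z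
    using that by (intro boundary_in_boundaries generator_in_chains) auto
  define \<psi> where "\<psi> = (\<lambda>x y. frag_of [x, y] - frag_of [\<one>\<^bsub>G\<^esub>, \<one>\<^bsub>G\<^esub>])"
  define \<phi> where "\<phi> = (\<lambda>x y. bar_class 2 G (\<psi> x y))"
  let ?E = "cocycle_extension G ?M \<phi>"
  have \<psi>: "\<psi> x y \<in> ?C" if "x \<in> carrier G" "y \<in> carrier G" for x y
    using that by (simp add: \<psi>_def bar_chains_diff C2)
  have \<phi>: "\<phi> x y \<in> carrier ?M" if "x \<in> carrier G" "y \<in> carrier G" for x y
    using \<psi>[OF that] by (simp add: \<phi>_def bar_class_closed[OF grps(1)])
  have grpE: "group ?E"
  proof (rule group_cocycle_extension[OF grps(1) M.comm_group_axioms \<phi>])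
    fix x y z assume *: "x \<in> carrier G" "y \<in> carrier G" "z \<in> carrier G"
    have "\<psi> x y + \<psi> (x \<otimes>\<^bsub>G\<^esub> y) z - (\<psi> y z + \<psi> x (y \<otimes>\<^bsub>G\<^esub> z)) = - bar_boundary G (frag_of [x, y, z])"
      by (simp add: \<psi>_def bar_boundary_simps)
    also have "\<dots> \<in> ?N" using * by (intro N_minus N3)
    finally have "bar_class 2 G (\<psi> x y + \<psi> (x \<otimes>\<^bsub>G\<^esub> y) z) = bar_class 2 G (\<psi> y z + \<psi> x (y \<otimes>\<^bsub>G\<^esub> z))"
      using * by (subst bar_class_eq_iff[OF grps(1)]) (simp_all add: add_closed \<psi>)
    then show "\<phi> x y \<otimes>\<^bsub>?M\<^esub> \<phi> (x \<otimes>\<^bsub>G\<^esub> y) z = \<phi> y z \<otimes>\<^bsub>?M\<^esub> \<phi> x (y \<otimes>\<^bsub>G\<^esub> z)"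
      using * by (simp add: \<phi>_def \<psi> bar_class_add[OF grps(1)])
  next
    fix x assume *: "x \<in> carrier G"
    have "\<psi> \<one>\<^bsub>G\<^esub> x = bar_boundary G (frag_of [\<one>\<^bsub>G\<^esub>, \<one>\<^bsub>G\<^esub>, x])"
      using * by (simp add: \<psi>_def bar_boundary_simps)
    also have "\<dots> \<in> ?N" using * by (intro N3) auto
    finally show "\<phi> \<one>\<^bsub>G\<^esub> x = \<one>\<^bsub>?M\<^esub>"
      using * \<psi> by (simp add: \<phi>_def bar_class_eq_one[OF grps(1)])
  qed
  \<comment> \<open>Triviality of \<open>H\<^sub>1(G)\<close> enters through the choice of \<open>w\<close>.\<close>
  have \<phi>_central: "\<phi> a x = \<phi> x a" if a: "a \<in> group_center G" and x: "x \<in> carrier G" for a x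
  proof -
    have aG: "a \<in> carrier G" using a by (simp add: group_center_def)
    obtain w where w: "w \<in> ?C" "bar_boundary G w = frag_of [x]"
      using universal_H1_trivial[OF univ x] by (force simp: bar_boundaries_def numeral_2_eq_2)
    have "\<psi> a x - \<psi> x a = shuffle a (frag_of [x])"
      by (simp add: \<psi>_def shuffle_simps)
    also have "\<dots> = - bar_boundary G (shuffle a w)"
      using boundary_shuffle[OF grps(1) a w(1)] w(2) by simp
    also have "\<dots> \<in> ?N" by (intro N_minus boundary_in_boundaries shuffle_in_chains aG w(1))
    finally show ?thesis
      using \<psi> aG x by (simp add: \<phi>_def bar_class_eq_iff[OF grps(1)])
  qed
  have carE: "carrier ?E = carrier G \<times> carrier ?M"
    and multE: "\<And>g m h n. (g, m) \<otimes>\<^bsub>?E\<^esub> (h, n) = (g \<otimes>\<^bsub>G\<^esub> h, m \<otimes>\<^bsub>?M\<^esub> n \<otimes>\<^bsub>?M\<^esub> \<phi> g h)"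
    by (simp_all add: cocycle_extension_def)
  define q where "q = (p \<circ> fst :: 'g \<times> ('g list \<Rightarrow>\<^sub>0 int) set \<Rightarrow> _)"
  have "q \<in> hom ?E Q"
    by (rule homI) (use p in \<open>auto simp: q_def carE multE hom_def\<close>)
  moreover have "q ` carrier ?E = carrier Q"
    unfolding q_def carE image_comp[symmetric] using p(2) M.one_closed by (metis empty_iff fst_image_times)
  ultimately have "q \<in> epi ?E Q" by (simp add: epi_def)
  moreover have "kernel ?E Q q \<subseteq> group_center ?E"
  proof
    fix t assume t: "t \<in> kernel ?E Q q"
    obtain a m where am: "t = (a, m)" by force
    have m: "m \<in> carrier ?M" and a: "a \<in> group_center G"
      using t ker by (auto simp: am kernel_def q_def carE)
    then have comm: "a \<otimes>\<^bsub>G\<^esub> x = x \<otimes>\<^bsub>G\<^esub> a" and aG: "a \<in> carrier G" if "x \<in> carrier G" for x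
      using that by (simp_all add: group_center_def)
    have "t \<otimes>\<^bsub>?E\<^esub> s = s \<otimes>\<^bsub>?E\<^esub> t" if "s \<in> carrier ?E" for s
      using that m comm \<phi>_central[OF a] M.m_comm by (auto simp: am carE multE)
    moreover have "t \<in> carrier ?E" using t by (simp add: kernel_def)
    ultimately show "t \<in> group_center ?E" by (simp add: group_center_def)
  qed
  ultimately have extE: "central_extension (?E\<lparr>carrier := kernel ?E Q q\<rparr>) ?E Q id q"
    using grpE grps(2) by (intro central_extension_kernel)
  obtain f where f: "f \<in> hom G ?E" "\<forall>x\<in>carrier G. q (f x) = p x"
    using universal_central_extension_universal[OF univ extE] by blast
  have f_closed: "f x \<in> carrier G \<times> carrier ?M" if "x \<in> carrier G" for x
    using f(1) that by (auto simp: hom_def carE)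
  have f_mult: "f (x \<otimes>\<^bsub>G\<^esub> y) = f x \<otimes>\<^bsub>?E\<^esub> f y" if "x \<in> carrier G" "y \<in> carrier G" for x y
    using hom_mult[OF f(1) that] .
  have fst_f: "(fst \<circ> f) x = id x" if "x \<in> carrier G" for x
  proof (rule universal_lift_unique[OF univ ext _ _ _ _ that])
    show "fst \<circ> f \<in> hom G G"
    proof (rule homI)
      fix x y assume *: "x \<in> carrier G" "y \<in> carrier G"
      show "(fst \<circ> f) (x \<otimes>\<^bsub>G\<^esub> y) = (fst \<circ> f) x \<otimes>\<^bsub>G\<^esub> (fst \<circ> f) y"
        unfolding comp_def f_mult[OF *] by (cases "f x"; cases "f y") (simp add: multE)
    qed (use f_closed in \<open>auto simp: mem_Times_iff\<close>)
    show "id \<in> hom G G" by (simp add: hom_def)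
    show "p ((fst \<circ> f) x) = p x" if "x \<in> carrier G" for x using f(2) that by (simp add: q_def)
  qed simp
  define \<sigma> where "\<sigma> = (\<lambda>x. SOME c. c \<in> ?C \<and> snd (f x) = bar_class 2 G c)"
  have \<sigma>: "\<sigma> x \<in> ?C" "snd (f x) = bar_class 2 G (\<sigma> x)" if "x \<in> carrier G" for x
  proof -
    have "snd (f x) \<in> carrier ?M" using f_closed[OF that] by auto
    then have "\<exists>c. c \<in> ?C \<and> snd (f x) = bar_class 2 G c" using bar_class_surj[OF grps(1)] by blast
    from someI_ex[OF this] show "\<sigma> x \<in> ?C" "snd (f x) = bar_class 2 G (\<sigma> x)" by (simp_all add: \<sigma>_def)
  qed
  have \<sigma>_add: "\<sigma> (x \<otimes>\<^bsub>G\<^esub> y) - (\<sigma> x + \<sigma> y + \<psi> x y) \<in> ?N" if *: "x \<in> carrier G" "y \<in> carrier G" for x y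
  proof -
    have fx: "f z = (z, bar_class 2 G (\<sigma> z))" if "z \<in> carrier G" for z
      using fst_f[OF that] \<sigma>(2)[OF that] by (simp add: prod_eq_iff)
    have "bar_class 2 G (\<sigma> (x \<otimes>\<^bsub>G\<^esub> y)) = bar_class 2 G (\<sigma> x + \<sigma> y + \<psi> x y)"
    proof -
      have "bar_class 2 G (\<sigma> (x \<otimes>\<^bsub>G\<^esub> y)) =
          bar_class 2 G (\<sigma> x) \<otimes>\<^bsub>?M\<^esub> bar_class 2 G (\<sigma> y) \<otimes>\<^bsub>?M\<^esub> \<phi> x y"
        using f_mult[OF *] * by (simp add: fx multE)
      then show ?thesis
        using * \<sigma>(1) \<psi> by (simp add: \<phi>_def bar_class_add[OF grps(1)] add_closed)
    qed
    then show ?thesis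
      using * \<sigma>(1) \<psi> by (subst (asm) bar_class_eq_iff[OF grps(1)]) (simp_all add: add_closed)
  qed
  \<comment> \<open>The shift by \<open>[1|1]\<close> undoes the normalisation: \<open>[x|y]\<close> becomes \<open>s(x y) - s(x) - s(y)\<close>.\<close>
  define s where "s = (\<lambda>xs. \<sigma> (xs ! 0) - frag_of [\<one>\<^bsub>G\<^esub>, \<one>\<^bsub>G\<^esub>])"
  fix z assume "z \<in> bar_cycles 2 G"
  then have keys: "Poly_Mapping.keys z \<subseteq> bar_tuples 2 G" and bd: "bar_boundary G z = 0"
    by (auto simp: bar_cycles_def bar_chain_group_def)
  from keys have "z + frag_extend s (bar_boundary G z) \<in> ?N"
  proof (induction z rule: frag_induction)
    case (one xs)
    then obtain x y where xs: "xs = [x, y]" and *: "x \<in> carrier G" "y \<in> carrier G"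
      by (auto simp: bar_tuples_def length_Suc_conv eval_nat_numeral)
    have "frag_of xs + frag_extend s (bar_boundary G (frag_of xs)) =
        - (\<sigma> (x \<otimes>\<^bsub>G\<^esub> y) - (\<sigma> x + \<sigma> y + \<psi> x y))"
      by (simp add: xs bar_boundary_simps frag_extend_add frag_extend_diff s_def \<psi>_def)
    also have "\<dots> \<in> ?N" by (intro N_minus \<sigma>_add *)
    finally show ?case .
  next
    case (diff a b)
    then show ?case
      using N_diff[OF diff] by (simp add: bar_boundary_diff frag_extend_diff algebra_simps)
  qed simp
  then show "z \<in> ?N" by (simp add: bd)
qed

section \<open>The image of the third homology of the kernel\<close>

theorem corollary3p3:
  fixes A :: "('a, 'k) monoid_scheme" and G :: "('g, 'l) monoid_scheme" and Q :: "('q, 'm) monoid_scheme"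
    and i :: "'a \<Rightarrow> 'g" and p :: "'g \<Rightarrow> 'q"
  assumes "universal_central_extension A G Q i p"
  shows "\<forall>x \<in> group_homology_map 3 G i ` carrier (group_homology 3 A).
           x [^]\<^bsub>group_homology 3 G\<^esub> (2::nat) = \<one>\<^bsub>group_homology 3 G\<^esub>"
proof
  have ext: "central_extension A G Q i p"
    using assms by (simp add: universal_central_extension_def)
  then have grps: "group A" "group G" and i: "i \<in> hom A G" "i ` carrier A \<subseteq> group_center G"
    by (auto simp: central_extension_def mon_def)
  interpret superperfect_group G
    using grps(2) universal_H1_trivial[OF assms] universal_H2_trivial[OF assms]
    by (simp add: superperfect_group_def superperfect_group_axioms_def)
  have i_center: "i \<in> hom A (center_group G)"
    using i by (auto simp: hom_def)
  interpret Z: comm_group "bar_cycle_group 3 G" by (rule comm_group_bar_cycle_group)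
  interpret N: normal "bar_boundaries 3 G" "bar_cycle_group 3 G" by (rule normal_bar_boundaries[OF grps(2)])
  interpret H: comm_group "group_homology 3 G" by (rule comm_group_group_homology[OF grps(2)])
  fix x assume "x \<in> group_homology_map 3 G i ` carrier (group_homology 3 A)"
  then obtain c where c: "c \<in> bar_cycles 3 A"
    and x: "x = group_homology_map 3 G i (bar_boundaries 3 A #>\<^bsub>bar_cycle_group 3 A\<^esub> c)"
    by (auto simp: group_homology_def FactGroup_def RCOSETS_def)
  define d where "d = bar_map i c"
  have x_d: "x = bar_boundaries 3 G #>\<^bsub>bar_cycle_group 3 G\<^esub> d"
    unfolding x d_def by (rule group_homology_map_coset[OF grps i(1) c])
  have d: "d \<in> bar_cycles 3 G" unfolding d_def by (rule bar_map_cycles[OF i(1) c])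
  have dd: "d + d \<in> bar_boundaries 3 G"
    unfolding d_def by (rule double_central_3_cycle[OF bar_map_cycles[OF i_center c]])
  have "x \<in> carrier (group_homology 3 G)"
    using d by (auto simp: x_d group_homology_def FactGroup_def RCOSETS_def)
  then have "x [^]\<^bsub>group_homology 3 G\<^esub> (2::nat) = x \<otimes>\<^bsub>group_homology 3 G\<^esub> x"
    by (simp add: numeral_2_eq_2)
  also have "\<dots> = bar_boundaries 3 G #>\<^bsub>bar_cycle_group 3 G\<^esub> (d + d)"
    using N.rcos_sum[of d d] d by (simp add: x_d group_homology_def)
  also have "\<dots> = bar_boundaries 3 G"
    using dd N.subset by (intro Z.coset_join2 N.subgroup_axioms) auto
  finally show "x [^]\<^bsub>group_homology 3 G\<^esub> (2::nat) = \<one>\<^bsub>group_homology 3 G\<^esub>"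
    by (simp add: group_homology_def)
qed

end
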